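(* Let $k$ be a field and let $I\subseteq R=k[x_1,\ldots,x_n]$ be a $C$-matroidal ideal. Then for every $\ell\ge1$, $$\operatorname{sdefect}(I,\ell)=\mu(I^{(\ell)})-\sum_{r=1}^{\operatorname{Mgrade}(I)}\bigl|SF(I^r)\cap G(I^{(r)})\bigr|\binom{\ell-1}{\ell-r}.$$
   Context: A matroid on $[n]$ is identified with the simplicial complex whose facets are its bases (loops allowed). For $F\subseteq[n]$, $\mathfrak p_F=(x_i:i\in F)$. A squarefree monomial ideal is $C$-matroidal if it is the Stanley--Reisner ideal $I_\Delta=\bigcap_{F}\mathfrak p_{[n]-F}$ (intersection over the bases $F$) of a matroid $\Delta$ on $[n]$; equivalently, it is the cover ideal $\bigcap_F\mathfrak p_F$ of a matroid on $[n]$ (the dual one). For a squarefree monomial ideal $I$, $I^{(\ell)}=\bigcap_{\mathfrak p\in\operatorname{Ass}(R/I)}\mathfrak p^\ell$. $\mu(M)$ is the minimal number of generators of a finitely generated graded $R$-module $M$. The $\ell$-th symbolic defect is $\operatorname{sdefect}(I,\ell)=\mu(I^{(\ell)}/I^\ell)$. For a monomial ideal $L$, $G(L)$ is its unique minimal generating set consisting of monomials, and $SF(L)$ is the ideal generated by all squarefree monomials in $L$. $\operatorname{Mgrade}(I)$ is the maximal length of a regular sequence consisting of monomials in $I$. The binomial coefficient $\binom{\ell-1}{\ell-r}$ is $0$ when $r>\ell$. *)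

theory Defs
  imports
    "HOL-Algebra.Ideal_Product"
    "HOL-Algebra.QuotRing"
    "HOL-Algebra.Module"
    "HOL-Algebra.Algebraic_Closure_Type"
    "HOL-Library.Poly_Mapping"
begin

section \<open>The polynomial ring and its monomials\<close>

text \<open>
  The ground set \<open>[n]\<close> is the universe of a finite type \<open>'n\<close>. A polynomial maps exponent vectors
  (of type \<open>'n \<Rightarrow>\<^sub>0 nat\<close>) to coefficients, and multiplication is convolution.
\<close>

type_synonym ('n, 'k) mpoly = "('n \<Rightarrow>\<^sub>0 nat) \<Rightarrow>\<^sub>0 'k"

abbreviation mpoly_ring :: "('n::finite, 'k::field) mpoly ring" where
  "mpoly_ring \<equiv> ring_of_type_algebra"

definition monomial :: "('n \<Rightarrow>\<^sub>0 nat) \<Rightarrow> ('n::finite, 'k::field) mpoly" where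
  "monomial e = Poly_Mapping.single e 1"

definition var :: "'n \<Rightarrow> ('n::finite, 'k::field) mpoly" where
  "var i = monomial (Poly_Mapping.single i 1)"

definition monomials :: "('n::finite, 'k::field) mpoly set" where
  "monomials = range monomial"

definition squarefree_monomials :: "('n::finite, 'k::field) mpoly set" where
  "squarefree_monomials = {monomial e | e. \<forall>i. Poly_Mapping.lookup e i \<le> 1}"

section \<open>Matroids and C-matroidal ideals\<close>

definition simplicial_complex :: "'n set set \<Rightarrow> bool" where
  "simplicial_complex \<Delta> \<longleftrightarrow> {} \<in> \<Delta> \<and> (\<forall>F\<in>\<Delta>. \<forall>G. G \<subseteq> F \<longrightarrow> G \<in> \<Delta>)"

definition facets :: "'n set set \<Rightarrow> 'n set set" where
  "facets \<Delta> = {F \<in> \<Delta>. \<forall>G\<in>\<Delta>. F \<subseteq> G \<longrightarrow> G = F}"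

text \<open>
  A matroid is given by its complex of independent sets, so its bases are the facets, subject to
  basis exchange. Singletons need not be faces: the missing ones are the loops.
\<close>

definition matroid :: "'n::finite set set \<Rightarrow> bool" where
  "matroid \<Delta> \<longleftrightarrow> simplicial_complex \<Delta> \<and>
    (\<forall>F\<in>facets \<Delta>. \<forall>G\<in>facets \<Delta>. \<forall>i\<in>F - G. \<exists>j\<in>G - F. insert j (F - {i}) \<in> facets \<Delta>)"

definition var_prime :: "'n set \<Rightarrow> ('n::finite, 'k::field) mpoly set" where
  "var_prime F = Idl\<^bsub>mpoly_ring\<^esub> (var ` F)"

definition stanley_reisner :: "'n set set \<Rightarrow> ('n::finite, 'k::field) mpoly set" where
  "stanley_reisner \<Delta> = (\<Inter>F\<in>facets \<Delta>. var_prime (UNIV - F))"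

definition C_matroidal :: "('n::finite, 'k::field) mpoly set \<Rightarrow> bool" where
  "C_matroidal I \<longleftrightarrow> (\<exists>\<Delta>. matroid \<Delta> \<and> I = stanley_reisner \<Delta>)"

section \<open>Modules and numbers of generators\<close>

text \<open>
  The record type \<open>module\<close> extends that of rings; the fields \<open>mult\<close> and \<open>one\<close> play no
  role for a module.
\<close>

definition ideal_module :: "'a ring \<Rightarrow> 'a set \<Rightarrow> ('a, 'a) module" where
  "ideal_module R I =
    \<lparr>carrier = I, monoid.mult = monoid.mult R, one = one R, zero = zero R, add = add R, module.smult = monoid.mult R\<rparr>"

definition quotient_module :: "('a, 'b) module \<Rightarrow> 'b set \<Rightarrow> ('a, 'b set) module" where
  "quotient_module M N =
    \<lparr>carrier = a_rcosets\<^bsub>M\<^esub> N, monoid.mult = rcoset_mult M N, one = N +>\<^bsub>M\<^esub> \<one>\<^bsub>M\<^esub>,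
     zero = N, add = set_add M, module.smult = (\<lambda>a A. \<Union>x\<in>A. N +>\<^bsub>M\<^esub> (a \<odot>\<^bsub>M\<^esub> x))\<rparr>"

definition generated_submodule :: "'a ring \<Rightarrow> ('a, 'b) module \<Rightarrow> 'b set \<Rightarrow> 'b set" where
  "generated_submodule R M S = \<Inter>{N. submodule N R M \<and> S \<subseteq> N}"

definition min_num_gens :: "'a ring \<Rightarrow> ('a, 'b) module \<Rightarrow> nat" where
  "min_num_gens R M =
    (LEAST k. \<exists>S. S \<subseteq> carrier M \<and> finite S \<and> card S = k \<and> generated_submodule R M S = carrier M)"

section \<open>Ordinary and symbolic powers\<close>

definition ideal_power :: "'a ring \<Rightarrow> 'a set \<Rightarrow> nat \<Rightarrow> 'a set" where
  "ideal_power R I l = I [^]\<^bsub>ideals_set R\<^esub> l"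

definition associated_primes :: "'a ring \<Rightarrow> ('a, 'b) module \<Rightarrow> 'a set set" where
  "associated_primes R M =
    {P. primeideal P R \<and> (\<exists>m\<in>carrier M. P = {a \<in> carrier R. a \<odot>\<^bsub>M\<^esub> m = \<zero>\<^bsub>M\<^esub>})}"

text \<open>
  This is the symbolic power only for ideals such as squarefree monomial ones, which are
  intersections of primes generated by variables.
\<close>

definition symbolic_power :: "'a ring \<Rightarrow> 'a set \<Rightarrow> nat \<Rightarrow> 'a set" where
  "symbolic_power R I l =
    (\<Inter>P\<in>associated_primes R (quotient_module (ideal_module R (carrier R)) I). ideal_power R P l)"

definition sdefect :: "'a ring \<Rightarrow> 'a set \<Rightarrow> nat \<Rightarrow> nat" where
  "sdefect R I l =
    min_num_gens R (quotient_module (ideal_module R (symbolic_power R I l)) (ideal_power R I l))"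

section \<open>Invariants of monomial ideals\<close>

text \<open>
  Monomials have coefficient 1, which is what makes the minimal monomial generating set of a
  monomial ideal unique.
\<close>

definition min_monomial_gens :: "('n::finite, 'k::field) mpoly set \<Rightarrow> ('n, 'k) mpoly set" where
  "min_monomial_gens L =
    (THE G. G \<subseteq> monomials \<and> Idl\<^bsub>mpoly_ring\<^esub> G = L \<and> (\<forall>H. H \<subset> G \<longrightarrow> Idl\<^bsub>mpoly_ring\<^esub> H \<noteq> L))"

definition SF :: "('n::finite, 'k::field) mpoly set \<Rightarrow> ('n, 'k) mpoly set" where
  "SF L = Idl\<^bsub>mpoly_ring\<^esub> (squarefree_monomials \<inter> L)"

text \<open>
  The second conjunct says that \<open>fs ! i\<close> is a nonzerodivisor on the quotient by the previous
  elements.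
\<close>

definition regular_sequence :: "'a ring \<Rightarrow> 'a list \<Rightarrow> bool" where
  "regular_sequence R fs \<longleftrightarrow> set fs \<subseteq> carrier R \<and>
    (\<forall>i<length fs. \<forall>g\<in>carrier R.
      fs ! i \<otimes>\<^bsub>R\<^esub> g \<in> Idl\<^bsub>R\<^esub> (set (take i fs)) \<longrightarrow> g \<in> Idl\<^bsub>R\<^esub> (set (take i fs))) \<and>
    Idl\<^bsub>R\<^esub> (set fs) \<noteq> carrier R"

definition Mgrade :: "('n::finite, 'k::field) mpoly set \<Rightarrow> nat" where
  "Mgrade I = Max {length fs | fs. regular_sequence mpoly_ring fs \<and> set fs \<subseteq> I \<inter> monomials}"

end

theory Submission
  imports Defs
begin

text \<open>
  Let \<open>\<B>\<close> be the set of complements of bases and \<open>k(B)\<close> the degree of the monomial \<open>x\<^sup>k\<close> in the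
  variables of \<open>B\<close>. Then \<open>x\<^sup>k\<close> lies in the \<open>l\<close>-th symbolic power iff \<open>k(B) \<ge> l\<close> for all \<open>B \<in> \<B>\<close>, and it
  lies in the \<open>l\<close>-th ordinary power iff it is divisible by a product of \<open>l\<close> monomials of circuits. The
  symbolic defect is the number of minimal monomial generators of the symbolic power outside the
  ordinary power, so one has to count the minimal generators that are products of \<open>l\<close> circuits. Such a
  product is a minimal generator iff each of its variables lies in some \<open>B\<close> meeting each of its
  circuits exactly once. This condition only depends on the set \<open>D\<close> of circuits that occur, not on their
  multiplicities. It forces these circuits to be pairwise disjoint, because two circuits meeting
  \<open>B\<close> in the same single element coincide; hence the multiplicities are determined by the product.
  For \<open>|D| = r\<close> the multiplicities are the \<open>(l - 1) choose (l - r)\<close> compositions of \<open>l\<close> into \<open>r\<close> parts, the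
  admissible \<open>D\<close> correspond to their squarefree products, and since disjoint circuits form a
  regular sequence, \<open>r\<close> is at most the monomial grade.
\<close>

section \<open>Monomial ideals\<close>

lemma type_ring_simps [simp]:
  "carrier (ring_of_type_algebra :: 'a::comm_ring_1 ring) = UNIV"
  "x \<otimes>\<^bsub>ring_of_type_algebra\<^esub> y = x * (y :: 'a)"
  "x \<oplus>\<^bsub>ring_of_type_algebra\<^esub> y = x + (y :: 'a)"
  "\<one>\<^bsub>ring_of_type_algebra\<^esub> = (1 :: 'a)"
  "\<zero>\<^bsub>ring_of_type_algebra\<^esub> = (0 :: 'a)"
  by (simp_all add: ring_of_type_algebra_def)

lemma type_ring_inv [simp]:
  fixes x :: "'a::comm_ring_1"
  shows "inv\<^bsub>add_monoid ring_of_type_algebra\<^esub> x = - x"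
proof -
  interpret ring "ring_of_type_algebra :: 'a ring" by rule
  have "\<ominus>\<^bsub>ring_of_type_algebra\<^esub> x = - x"
    by (rule minus_equality) auto
  then show ?thesis by (simp add: a_inv_def)
qed

text \<open>Closure under negation comes from multiplying by -1. The criterion allows ideals to be
  checked elementwise, away from the ring record.\<close>

lemma ideal_type_ring_iff:
  fixes J :: "'a::comm_ring_1 set"
  shows "ideal J ring_of_type_algebra \<longleftrightarrow>
    0 \<in> J \<and> (\<forall>x\<in>J. \<forall>y\<in>J. x + y \<in> J) \<and> (\<forall>a. \<forall>x\<in>J. a * x \<in> J)"
    (is "?L \<longleftrightarrow> ?R")
proof
  assume J: ?L
  note add = ideal.axioms(1)[OF J]
  show ?R
    using additive_subgroup.zero_closed[OF add] additive_subgroup.a_closed[OF add]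
      ideal.I_l_closed[OF J] by auto
next
  assume R: ?R
  have "- x \<in> J" if "x \<in> J" for x
    using R that by (metis mult_minus1)
  with R have "subgroup J (add_monoid (ring_of_type_algebra :: 'a ring))"
    by (intro subgroup.intro) (simp_all only: type_ring_inv, simp_all)
  moreover have "ring (ring_of_type_algebra :: 'a ring)" by rule
  moreover have "x * a \<in> J" if "x \<in> J" for x a
    using R that by (metis mult.commute)
  ultimately show ?L
    using R by (intro idealI) auto
qed

section \<open>Divisibility of exponent vectors\<close>

definition edvd :: "('n \<Rightarrow>\<^sub>0 nat) \<Rightarrow> ('n \<Rightarrow>\<^sub>0 nat) \<Rightarrow> bool" (infix "\<preceq>" 50) where
  "a \<preceq> b \<longleftrightarrow> (\<forall>i. Poly_Mapping.lookup a i \<le> Poly_Mapping.lookup b i)"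

definition upset :: "('n \<Rightarrow>\<^sub>0 nat) set \<Rightarrow> bool" where
  "upset U \<longleftrightarrow> (\<forall>a\<in>U. \<forall>b. a \<preceq> b \<longrightarrow> b \<in> U)"

definition up :: "('n \<Rightarrow>\<^sub>0 nat) set \<Rightarrow> ('n \<Rightarrow>\<^sub>0 nat) set" where
  "up A = {b. \<exists>a\<in>A. a \<preceq> b}"

definition minimal :: "('n \<Rightarrow>\<^sub>0 nat) set \<Rightarrow> ('n \<Rightarrow>\<^sub>0 nat) set" where
  "minimal U = {e \<in> U. \<forall>a\<in>U. a \<preceq> e \<longrightarrow> a = e}"

text \<open>The span over the field of the monomials with exponent in \<open>U\<close>, an ideal
  once \<open>U\<close> is an upset. Computations with monomial ideals thus become computations with
  sets of exponents.\<close>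

definition monomial_ideal :: "('n \<Rightarrow>\<^sub>0 nat) set \<Rightarrow> ('n::finite, 'k::field) mpoly set" where
  "monomial_ideal U = {p. Poly_Mapping.keys p \<subseteq> U}"

lemma edvd_refl [simp]: "a \<preceq> a"
  by (simp add: edvd_def)

lemma edvd_trans [trans]: "a \<preceq> b \<Longrightarrow> b \<preceq> c \<Longrightarrow> a \<preceq> c"
  by (meson edvd_def le_trans)

lemma edvd_antisym: "a \<preceq> b \<Longrightarrow> b \<preceq> a \<Longrightarrow> a = b"
  by (auto simp: edvd_def intro!: poly_mapping_eqI le_antisym)

lemma edvd_add [simp]: "a \<preceq> a + b" "a \<preceq> b + a"
  by (auto simp: edvd_def lookup_add)

lemma edvd_diff_add: "a \<preceq> b \<Longrightarrow> a + (b - a) = b"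
  by (auto simp: edvd_def lookup_add lookup_minus intro!: poly_mapping_eqI)

lemma edvd_single_diff: "a - Poly_Mapping.single i c \<preceq> a"
  by (auto simp: edvd_def lookup_minus)

lemma upset_up: "upset (up A)"
  by (auto simp: upset_def up_def intro: edvd_trans)

lemma subset_up: "A \<subseteq> up A"
  using edvd_refl by (force simp: up_def)

lemma up_upset: "upset U \<Longrightarrow> up U = U"
  by (auto simp: upset_def up_def) (use edvd_refl in blast)

lemma upsetD: "upset U \<Longrightarrow> a \<in> U \<Longrightarrow> a \<preceq> b \<Longrightarrow> b \<in> U"
  by (auto simp: upset_def)

text \<open>Induction on the total degree: a non-minimal exponent has a proper divisor in
  \<open>U\<close>, which has smaller degree.\<close>

lemma ex_minimal_edvd:
  fixes U :: "('n::finite \<Rightarrow>\<^sub>0 nat) set"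
  assumes "b \<in> U"
  shows "\<exists>a\<in>minimal U. a \<preceq> b"
  using assms
proof (induction "\<Sum>i\<in>UNIV. Poly_Mapping.lookup b i" arbitrary: b rule: less_induct)
  case less
  show ?case
  proof (cases "b \<in> minimal U")
    case True
    then show ?thesis by (intro bexI[of _ b]) auto
  next
    case False
    then obtain c where c: "c \<in> U" "c \<preceq> b" "c \<noteq> b"
      using less.prems by (auto simp: minimal_def)
    then obtain j where "Poly_Mapping.lookup c j < Poly_Mapping.lookup b j"
      by (metis edvd_def poly_mapping_eqI le_neq_implies_less)
    with c(2) have "(\<Sum>i\<in>UNIV. Poly_Mapping.lookup c i) < (\<Sum>i\<in>UNIV. Poly_Mapping.lookup b i)"
      by (intro sum_strict_mono_ex1) (auto simp: edvd_def)
    with less.hyps c(1) obtain a where "a \<in> minimal U" "a \<preceq> c" by blast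
    with c(2) show ?thesis using edvd_trans by blast
  qed
qed

lemma up_minimal:
  fixes U :: "('n::finite \<Rightarrow>\<^sub>0 nat) set"
  assumes "upset U" shows "up (minimal U) = U"
proof -
  have "minimal U \<subseteq> U" by (auto simp: minimal_def)
  then show ?thesis
    using ex_minimal_edvd[of _ U] assms unfolding up_def upset_def by blast
qed

lemma monomial_add: "monomial (a + b) = monomial a * (monomial b :: ('n::finite, 'k::field) mpoly)"
  by (simp add: monomial_def mult_single)

lemma keys_monomial [simp]: "Poly_Mapping.keys (monomial e :: ('n::finite, 'k::field) mpoly) = {e}"
  by (simp add: monomial_def)

lemma inj_monomial: "inj (monomial :: _ \<Rightarrow> ('n::finite, 'k::field) mpoly)"
  by (metis injI keys_monomial singleton_inject)

lemma monomial_in_monomial_ideal [simp]: "monomial e \<in> monomial_ideal U \<longleftrightarrow> e \<in> U"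
  by (simp add: monomial_ideal_def)

lemma mpoly_eq_sum:
  "p = (\<Sum>k\<in>Poly_Mapping.keys p. Poly_Mapping.single 0 (Poly_Mapping.lookup p k) * monomial k)"
  for p :: "('n::finite, 'k::field) mpoly"
proof (rule poly_mapping_eqI)
  fix e
  have *: "(\<Sum>k\<in>Poly_Mapping.keys p. (Poly_Mapping.lookup p k when k = e)) =
      (\<Sum>k\<in>Poly_Mapping.keys p. if k = e then Poly_Mapping.lookup p e else 0)"
    by (intro sum.cong) (auto simp: when_def)
  show "Poly_Mapping.lookup p e = Poly_Mapping.lookup
      (\<Sum>k\<in>Poly_Mapping.keys p. Poly_Mapping.single 0 (Poly_Mapping.lookup p k) * monomial k) e"
    by (simp add: lookup_sum monomial_def mult_single lookup_single * in_keys_iff)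
qed

lemma keys_mult_edvd:
  fixes p q :: "('n::finite, 'k::field) mpoly"
  assumes "e \<in> Poly_Mapping.keys (p * q)"
  shows "\<exists>a\<in>Poly_Mapping.keys p. \<exists>b\<in>Poly_Mapping.keys q. e = a + b"
  using subsetD[OF keys_mult assms] by blast

lemma ideal_monomial_ideal:
  assumes "upset U"
  shows "ideal (monomial_ideal U :: ('n::finite, 'k::field) mpoly set) mpoly_ring"
proof -
  have "Poly_Mapping.keys (a * p) \<subseteq> U" if "Poly_Mapping.keys p \<subseteq> U" for a p :: "('n, 'k) mpoly"
    using that keys_mult_edvd[of _ a p] upsetD[OF assms _ edvd_add(2)] by blast
  moreover have "Poly_Mapping.keys (p + q) \<subseteq> U"
    if "Poly_Mapping.keys p \<subseteq> U" "Poly_Mapping.keys q \<subseteq> U" for p q :: "('n, 'k) mpoly"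
    using that keys_add[of p q] by blast
  ultimately show ?thesis
    by (auto simp: ideal_type_ring_iff monomial_ideal_def)
qed

text \<open>A polynomial is a linear combination of its monomials, and each of these is a multiple
  of a monomial in \<open>J\<close>. This inclusion serves wherever a set of monomials is shown to
  generate.\<close>

lemma monomial_ideal_up_subset:
  fixes J :: "('n::finite, 'k::field) mpoly set"
  assumes J: "ideal J mpoly_ring" and A: "monomial ` A \<subseteq> J"
  shows "monomial_ideal (up A) \<subseteq> J"
proof
  fix p :: "('n, 'k) mpoly"
  assume "p \<in> monomial_ideal (up A)"
  then have keys: "Poly_Mapping.keys p \<subseteq> up A" by (simp add: monomial_ideal_def)
  have "monomial k \<in> J" if "k \<in> up A" for k
    using that A J by (auto simp: up_def ideal_type_ring_iff)
      (metis edvd_diff_add image_subset_iff monomial_add mult.commute)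
  then have *: "Poly_Mapping.single 0 (Poly_Mapping.lookup p k) * monomial k \<in> J"
    if "k \<in> Poly_Mapping.keys p" for k
    using that keys J by (auto simp: ideal_type_ring_iff)
  have sum_in: "sum f S \<in> J" if "finite S" "\<And>x. x \<in> S \<Longrightarrow> f x \<in> J" for f :: "_ \<Rightarrow> ('n, 'k) mpoly" and S
    using that J by (induction S rule: finite_induct) (auto simp: ideal_type_ring_iff)
  show "p \<in> J"
    by (subst mpoly_eq_sum) (intro sum_in finite_keys *)
qed

lemma Idl_monomials:
  "Idl\<^bsub>mpoly_ring\<^esub> (monomial ` A) = (monomial_ideal (up A) :: ('n::finite, 'k::field) mpoly set)"
proof
  interpret ring "mpoly_ring :: ('n, 'k) mpoly ring" by rule
  show "Idl\<^bsub>mpoly_ring\<^esub> (monomial ` A) \<subseteq> (monomial_ideal (up A) :: ('n, 'k) mpoly set)"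
    by (rule genideal_minimal[OF ideal_monomial_ideal[OF upset_up]])
      (auto intro: subsetD[OF subset_up])
  show "monomial_ideal (up A) \<subseteq> Idl\<^bsub>mpoly_ring\<^esub> (monomial ` A :: ('n, 'k) mpoly set)"
    by (intro monomial_ideal_up_subset genideal_ideal genideal_self) auto
qed

lemma monomial_ideal_inject [simp]:
  "(monomial_ideal U :: ('n::finite, 'k::field) mpoly set) = monomial_ideal V \<longleftrightarrow> U = V"
  by (metis monomial_in_monomial_ideal subsetI subset_antisym)

lemma monomial_ideal_mono: "U \<subseteq> V \<Longrightarrow> monomial_ideal U \<subseteq> monomial_ideal V"
  by (auto simp: monomial_ideal_def)

lemma INT_monomial_ideal: "(\<Inter>F\<in>\<F>. monomial_ideal (U F)) = monomial_ideal (\<Inter>F\<in>\<F>. U F)"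
  by (auto simp: monomial_ideal_def)

section \<open>Products and powers of monomial ideals\<close>

definition sumset :: "('n \<Rightarrow>\<^sub>0 nat) set \<Rightarrow> ('n \<Rightarrow>\<^sub>0 nat) set \<Rightarrow> ('n \<Rightarrow>\<^sub>0 nat) set" where
  "sumset U V = {u + v | u v. u \<in> U \<and> v \<in> V}"

lemma upset_sumset: "upset U \<Longrightarrow> upset (sumset U V)"
proof -
  assume U: "upset U"
  have "b \<in> sumset U V" if "u \<in> U" "v \<in> V" and b: "u + v \<preceq> b" for u v b
  proof -
    have "b = (u + (b - (u + v))) + v"
      using edvd_diff_add[OF b] by (simp add: add_ac)
    moreover have "u + (b - (u + v)) \<in> U"
      using U \<open>u \<in> U\<close> edvd_add(1) by (rule upsetD)
    ultimately show ?thesis using \<open>v \<in> V\<close> by (auto simp: sumset_def)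
  qed
  then show ?thesis unfolding upset_def by (auto simp: sumset_def)
qed

lemma ideal_prod_monomial_ideal:
  assumes "upset U" "upset V"
  shows "ideal_prod mpoly_ring (monomial_ideal U) (monomial_ideal V) =
    (monomial_ideal (sumset U V) :: ('n::finite, 'k::field) mpoly set)"
proof
  interpret ring "mpoly_ring :: ('n, 'k) mpoly ring" by rule
  have I: "ideal (monomial_ideal (sumset U V) :: ('n, 'k) mpoly set) mpoly_ring"
    by (intro ideal_monomial_ideal upset_sumset assms)
  show "ideal_prod mpoly_ring (monomial_ideal U) (monomial_ideal V) \<subseteq>
    (monomial_ideal (sumset U V) :: ('n, 'k) mpoly set)"
  proof
    fix p :: "('n, 'k) mpoly"
    assume "p \<in> ideal_prod mpoly_ring (monomial_ideal U) (monomial_ideal V)"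
    then show "p \<in> monomial_ideal (sumset U V)"
    proof induction
      case (prod i j)
      have "Poly_Mapping.keys (i * j) \<subseteq> sumset U V"
        using prod keys_mult_edvd[of _ i j] unfolding monomial_ideal_def sumset_def by blast
      then show ?case by (simp add: monomial_ideal_def)
    next
      case (sum s1 s2)
      then show ?case using I by (simp add: ideal_type_ring_iff)
    qed
  qed
  have J: "ideal (ideal_prod mpoly_ring (monomial_ideal U) (monomial_ideal V :: ('n, 'k) mpoly set)) mpoly_ring"
    by (intro ideal_prod_is_ideal ideal_monomial_ideal assms)
  have "monomial (u + v) \<in> ideal_prod mpoly_ring (monomial_ideal U) (monomial_ideal V :: ('n, 'k) mpoly set)"
    if "u \<in> U" "v \<in> V" for u v
    using that ideal_prod.prod[of "monomial u" "monomial_ideal U" "monomial v" "monomial_ideal V" "mpoly_ring :: ('n, 'k) mpoly ring"]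
    by (simp add: monomial_add)
  then have "monomial ` sumset U V \<subseteq> ideal_prod mpoly_ring (monomial_ideal U) (monomial_ideal V :: ('n, 'k) mpoly set)"
    by (auto simp: sumset_def)
  from monomial_ideal_up_subset[OF J this]
  show "monomial_ideal (sumset U V) \<subseteq> ideal_prod mpoly_ring (monomial_ideal U) (monomial_ideal V :: ('n, 'k) mpoly set)"
    by (simp add: up_upset upset_sumset assms)
qed

text \<open>The start \<open>UNIV\<close> is the exponent set of the unit ideal, the zeroth
  power.\<close>

primrec sumset_pow :: "('n \<Rightarrow>\<^sub>0 nat) set \<Rightarrow> nat \<Rightarrow> ('n \<Rightarrow>\<^sub>0 nat) set" where
  "sumset_pow U 0 = UNIV"
| "sumset_pow U (Suc l) = sumset (sumset_pow U l) U"

lemma upset_sumset_pow: "upset (sumset_pow U l)"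
  by (induction l) (auto simp: upset_sumset upset_def[of UNIV])

lemma ideal_power_monomial_ideal:
  assumes "upset U"
  shows "ideal_power mpoly_ring (monomial_ideal U :: ('n::finite, 'k::field) mpoly set) l =
    monomial_ideal (sumset_pow U l)"
proof (induction l)
  case 0
  show ?case by (simp add: ideal_power_def ideals_set_def monomial_ideal_def)
next
  case (Suc l)
  have "ideal_power mpoly_ring (monomial_ideal U :: ('n, 'k) mpoly set) (Suc l) =
    ideal_prod mpoly_ring (monomial_ideal (sumset_pow U l)) (monomial_ideal U)"
    using Suc by (simp add: ideal_power_def ideals_set_def)
  then show ?case by (simp add: ideal_prod_monomial_ideal assms upset_sumset_pow)
qed

text \<open>Minimal exponents occur in every monomial generating set, because an element of
  \<open>U\<close> dividing a minimal exponent equals it. They already generate, so an irredundant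
  generating set contains nothing else, which makes the definite description well defined.\<close>

lemma min_monomial_gens_monomial_ideal:
  assumes U: "upset U"
  shows "min_monomial_gens (monomial_ideal U :: ('n::finite, 'k::field) mpoly set) = monomial ` minimal U"
  unfolding min_monomial_gens_def
proof (rule the_equality)
  have sub: "A \<subseteq> U \<and> minimal U \<subseteq> A" if "up A = U" for A
  proof
    show "A \<subseteq> U" using that edvd_refl unfolding up_def by blast
    then show "minimal U \<subseteq> A" using that unfolding minimal_def up_def by blast
  qed
  have irr: "Idl\<^bsub>mpoly_ring\<^esub> H \<noteq> (monomial_ideal U :: ('n, 'k) mpoly set)" if H: "H \<subset> monomial ` minimal U" for H
  proof
    assume eq: "Idl\<^bsub>mpoly_ring\<^esub> H = (monomial_ideal U :: ('n, 'k) mpoly set)"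
    obtain A where A: "H = monomial ` A"
      using H by (meson psubset_imp_subset subset_imageE)
    with eq have "minimal U \<subseteq> A" using sub by (simp add: Idl_monomials)
    with A H show False by blast
  qed
  then show "monomial ` minimal U \<subseteq> (monomials :: ('n, 'k) mpoly set) \<and>
    Idl\<^bsub>mpoly_ring\<^esub> (monomial ` minimal U) = (monomial_ideal U :: ('n, 'k) mpoly set) \<and>
    (\<forall>H\<subset>monomial ` minimal U. Idl\<^bsub>mpoly_ring\<^esub> H \<noteq> (monomial_ideal U :: ('n, 'k) mpoly set))"
    by (auto simp: monomials_def Idl_monomials up_minimal[OF U])
  fix G :: "('n, 'k) mpoly set"
  assume G: "G \<subseteq> monomials \<and> Idl\<^bsub>mpoly_ring\<^esub> G = monomial_ideal U \<and>
    (\<forall>H\<subset>G. Idl\<^bsub>mpoly_ring\<^esub> H \<noteq> monomial_ideal U)"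
  then obtain A where A: "G = monomial ` A" by (auto simp: monomials_def subset_image_iff)
  with G have "minimal U \<subseteq> A" using sub by (simp add: Idl_monomials)
  then have "monomial ` minimal U \<subseteq> G" using A by auto
  moreover have "Idl\<^bsub>mpoly_ring\<^esub> (monomial ` minimal U) = (monomial_ideal U :: ('n, 'k) mpoly set)"
    by (simp add: Idl_monomials up_minimal[OF U])
  ultimately show "G = monomial ` minimal U" using G by blast
qed

lemma SF_monomial_ideal:
  "SF (monomial_ideal U :: ('n::finite, 'k::field) mpoly set) =
    monomial_ideal (up {e \<in> U. \<forall>i. Poly_Mapping.lookup e i \<le> 1})"
proof -
  have "squarefree_monomials \<inter> (monomial_ideal U :: ('n, 'k) mpoly set) =
      monomial ` {e \<in> U. \<forall>i. Poly_Mapping.lookup e i \<le> 1}"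
    by (auto simp: squarefree_monomials_def)
  then show ?thesis by (simp add: SF_def Idl_monomials)
qed

section \<open>Minimal numbers of generators\<close>

definition ideal_coset :: "'a::comm_ring_1 set \<Rightarrow> 'a \<Rightarrow> 'a set" where
  "ideal_coset N x = (\<lambda>n. n + x) ` N"

lemma ideal_coset_eq_iff:
  assumes "ideal N (ring_of_type_algebra :: 'a::comm_ring_1 ring)"
  shows "ideal_coset N x = ideal_coset N y \<longleftrightarrow> x - y \<in> N"
proof -
  have N: "0 \<in> N" "\<And>a b. a \<in> N \<Longrightarrow> b \<in> N \<Longrightarrow> a + b \<in> N" "\<And>a. a \<in> N \<Longrightarrow> - a \<in> N"
    using assms unfolding ideal_type_ring_iff by (blast, blast, metis mult_minus1)
  have *: "ideal_coset N u \<subseteq> ideal_coset N v" if "u - v \<in> N" for u v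
  proof
    fix z assume "z \<in> ideal_coset N u"
    then obtain n where "n \<in> N" "z = n + u" by (auto simp: ideal_coset_def)
    then show "z \<in> ideal_coset N v"
      using N(2)[OF _ that, of n] unfolding ideal_coset_def
      by (intro image_eqI[of _ _ "n + (u - v)"]) auto
  qed
  show ?thesis
  proof
    assume "ideal_coset N x = ideal_coset N y"
    then have "0 + x \<in> ideal_coset N y" using N(1) unfolding ideal_coset_def by blast
    then show "x - y \<in> N" by (auto simp: ideal_coset_def)
  next
    assume "x - y \<in> N"
    with N(3)[OF this] show "ideal_coset N x = ideal_coset N y"
      by (intro equalityI *) auto
  qed
qed

lemma ideal_coset_zero: "ideal_coset N 0 = N"
  by (simp add: ideal_coset_def)

lemma ideal_module_simps [simp]:
  "carrier (ideal_module R J) = J"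
  "x \<oplus>\<^bsub>ideal_module R J\<^esub> y = x \<oplus>\<^bsub>R\<^esub> y"
  "\<zero>\<^bsub>ideal_module R J\<^esub> = \<zero>\<^bsub>R\<^esub>"
  "a \<odot>\<^bsub>ideal_module R J\<^esub> x = a \<otimes>\<^bsub>R\<^esub> x"
  by (simp_all add: ideal_module_def)

lemma group_ideal_module:
  assumes "ideal J (ring_of_type_algebra :: 'a::comm_ring_1 ring)"
  shows "group (add_monoid (ideal_module (ring_of_type_algebra :: 'a ring) J))"
proof (rule groupI)
  fix x assume "x \<in> carrier (add_monoid (ideal_module (ring_of_type_algebra :: 'a ring) J))"
  then have "- x \<in> J" using assms unfolding ideal_type_ring_iff by simp (metis mult_minus1)
  then show "\<exists>y\<in>carrier (add_monoid (ideal_module ring_of_type_algebra J)).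
      y \<otimes>\<^bsub>add_monoid (ideal_module ring_of_type_algebra J)\<^esub> x =
      \<one>\<^bsub>add_monoid (ideal_module ring_of_type_algebra J)\<^esub>"
    by (intro bexI[of _ "- x"]) auto
qed (use assms in \<open>auto simp: ideal_type_ring_iff add_ac\<close>)

lemma quotient_ideal_module_simps:
  assumes J: "ideal J (ring_of_type_algebra :: 'a::comm_ring_1 ring)"
    and N: "ideal N (ring_of_type_algebra :: 'a ring)" "N \<subseteq> J"
  defines "Q \<equiv> quotient_module (ideal_module ring_of_type_algebra J) N"
  shows "carrier Q = ideal_coset N ` J"
    and "\<zero>\<^bsub>Q\<^esub> = N"
    and "x \<in> J \<Longrightarrow> y \<in> J \<Longrightarrow> ideal_coset N x \<oplus>\<^bsub>Q\<^esub> ideal_coset N y = ideal_coset N (x + y)"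
    and "x \<in> J \<Longrightarrow> a \<odot>\<^bsub>Q\<^esub> ideal_coset N x = ideal_coset N (a * x)"
proof -
  have coset: "N +>\<^bsub>ideal_module ring_of_type_algebra J\<^esub> x = ideal_coset N x" for x
    by (auto simp: a_r_coset_def' ideal_coset_def)
  have closed: "0 \<in> N" "\<And>a b. a \<in> N \<Longrightarrow> b \<in> N \<Longrightarrow> a + b \<in> N" "\<And>r a. a \<in> N \<Longrightarrow> r * a \<in> N"
    using N(1) by (auto simp: ideal_type_ring_iff)
  show "carrier Q = ideal_coset N ` J"
    by (auto simp: Q_def quotient_module_def A_RCOSETS_def' coset)
  show "\<zero>\<^bsub>Q\<^esub> = N"
    by (simp add: Q_def quotient_module_def)
  show "ideal_coset N x \<oplus>\<^bsub>Q\<^esub> ideal_coset N y = ideal_coset N (x + y)"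
  proof -
    have "\<exists>n\<in>N. p + x + (q + y) = n + (x + y)" if "p \<in> N" "q \<in> N" for p q
      using closed(2)[OF that] by (intro bexI[of _ "p + q"]) (auto simp: add_ac)
    moreover have "\<exists>p\<in>N. \<exists>q\<in>N. n + (x + y) = p + x + (q + y)" if "n \<in> N" for n
      using that closed(1) by (intro bexI[of _ n] bexI[of _ 0]) (auto simp: add_ac)
    ultimately show ?thesis
      unfolding Q_def quotient_module_def ideal_coset_def
      by (auto simp: set_add_def' image_iff)
  qed
  show "a \<odot>\<^bsub>Q\<^esub> ideal_coset N x = ideal_coset N (a * x)"
  proof -
    \<comment> \<open>The scalar action is a union of cosets over all representatives; these cosets
      coincide because \<open>N\<close> absorbs multiplication, so the union is a single
      coset.\<close>
    have "ideal_coset N (a * z) = ideal_coset N (a * x)" if "z \<in> ideal_coset N x" for z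
    proof -
      have "a * z - a * x \<in> N"
        using that closed(3) by (auto simp: ideal_coset_def algebra_simps)
      then show ?thesis using ideal_coset_eq_iff[OF N(1)] by blast
    qed
    moreover have "ideal_coset N x \<noteq> {}" using closed(1) by (auto simp: ideal_coset_def)
    ultimately show ?thesis
      unfolding Q_def quotient_module_def by (simp add: coset)
  qed
qed

lemma group_quotient_ideal_module:
  assumes J: "ideal J (ring_of_type_algebra :: 'a::comm_ring_1 ring)"
    and N: "ideal N (ring_of_type_algebra :: 'a ring)" "N \<subseteq> J"
  shows "group (add_monoid (quotient_module (ideal_module ring_of_type_algebra J) N))"
proof -
  note Q = quotient_ideal_module_simps[OF J N]
  have closed: "0 \<in> J" "\<And>a b. a \<in> J \<Longrightarrow> b \<in> J \<Longrightarrow> a + b \<in> J" "\<And>r a. a \<in> J \<Longrightarrow> r * a \<in> J"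
    using J by (auto simp: ideal_type_ring_iff)
  have neg: "- x \<in> J" if "x \<in> J" for x using closed(3)[OF that, of "- 1"] by simp
  show ?thesis
  proof (rule groupI)
    fix A assume "A \<in> carrier (add_monoid (quotient_module (ideal_module ring_of_type_algebra J) N))"
    then obtain x where x: "x \<in> J" "A = ideal_coset N x" by (auto simp: Q)
    then have "ideal_coset N (- x) \<oplus>\<^bsub>quotient_module (ideal_module ring_of_type_algebra J) N\<^esub> A = N"
      using neg by (simp add: Q ideal_coset_zero)
    then show "\<exists>B\<in>carrier (add_monoid (quotient_module (ideal_module ring_of_type_algebra J) N)).
        B \<otimes>\<^bsub>add_monoid (quotient_module (ideal_module ring_of_type_algebra J) N)\<^esub> A =
        \<one>\<^bsub>add_monoid (quotient_module (ideal_module ring_of_type_algebra J) N)\<^esub>"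
      using x neg by (intro bexI[of _ "ideal_coset N (- x)"]) (auto simp: Q)
  next
    show "\<one>\<^bsub>add_monoid (quotient_module (ideal_module ring_of_type_algebra J) N)\<^esub>
        \<in> carrier (add_monoid (quotient_module (ideal_module ring_of_type_algebra J) N))"
      using closed(1) by (auto simp: Q intro!: image_eqI[of _ _ 0] simp: ideal_coset_zero)
  next
    fix A assume "A \<in> carrier (add_monoid (quotient_module (ideal_module ring_of_type_algebra J) N))"
    then obtain x where x: "x \<in> J" "A = ideal_coset N x" by (auto simp: Q)
    have "ideal_coset N 0 \<oplus>\<^bsub>quotient_module (ideal_module ring_of_type_algebra J) N\<^esub> A = A"
      using x closed(1) by (simp add: Q)
    then show "\<one>\<^bsub>add_monoid (quotient_module (ideal_module ring_of_type_algebra J) N)\<^esub>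
        \<otimes>\<^bsub>add_monoid (quotient_module (ideal_module ring_of_type_algebra J) N)\<^esub> A = A"
      by (simp add: Q ideal_coset_zero)
  qed (use closed in \<open>auto simp: Q add_ac\<close>)
qed

section \<open>Bounding numbers of generators by linear algebra\<close>

lemma vector_space_mpoly:
  "vector_space (\<lambda>c (p :: ('n::finite, 'k::field) mpoly). Poly_Mapping.single 0 c * p)"
  by standard (simp_all add: algebra_simps single_add mult_single)

text \<open>The easy half of a Nakayama argument. Under \<psi> the ring acts through constant terms
  only, so a generating set of the module becomes a spanning set over the field of the image, and
  this image contains \<open>card E\<close> independent monomials.\<close>

lemma card_le_card_generators:
  fixes \<psi> :: "'b \<Rightarrow> ('n::finite, 'k::field) mpoly"
  assumes grp: "group (add_monoid M)"
    and add: "\<And>x y. x \<in> carrier M \<Longrightarrow> y \<in> carrier M \<Longrightarrow> \<psi> (x \<oplus>\<^bsub>M\<^esub> y) = \<psi> x + \<psi> y"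
    and smult: "\<And>a x. x \<in> carrier M \<Longrightarrow> a \<odot>\<^bsub>M\<^esub> x \<in> carrier M \<and>
      \<psi> (a \<odot>\<^bsub>M\<^esub> x) = Poly_Mapping.single 0 (Poly_Mapping.lookup a 0) * \<psi> x"
    and S: "S \<subseteq> carrier M" "finite S" "generated_submodule mpoly_ring M S = carrier M"
    and E: "monomial ` E \<subseteq> \<psi> ` carrier M"
  shows "card E \<le> card S"
proof -
  interpret vector_space "\<lambda>c (p :: ('n, 'k) mpoly). Poly_Mapping.single 0 c * p"
    by (rule vector_space_mpoly)
  interpret M: group "add_monoid M" by (rule grp)
  \<comment> \<open>The preimage of the span of the images of \<open>S\<close> is a submodule
    containing \<open>S\<close>, hence all of \<open>M\<close>.\<close>
  define N where "N = {x \<in> carrier M. \<psi> x \<in> span (\<psi> ` S)}"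
  have zero: "\<psi> \<zero>\<^bsub>M\<^esub> = 0"
    using add[of "\<zero>\<^bsub>M\<^esub>" "\<zero>\<^bsub>M\<^esub>"] M.one_closed M.r_one by simp
  have inv: "\<psi> (inv\<^bsub>add_monoid M\<^esub> x) = - \<psi> x" if "x \<in> carrier M" for x
    using add[of x "inv\<^bsub>add_monoid M\<^esub> x"] M.inv_closed[of x] M.r_inv[of x] that zero
    by (simp add: eq_neg_iff_add_eq_0 add.commute)
  have "subgroup N (add_monoid M)"
  proof (rule subgroup.intro)
    show "x \<otimes>\<^bsub>add_monoid M\<^esub> y \<in> N" if "x \<in> N" "y \<in> N" for x y
      using that M.m_closed[of x y] add span_add by (auto simp: N_def)
    show "inv\<^bsub>add_monoid M\<^esub> x \<in> N" if "x \<in> N" for x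
      using that M.inv_closed[of x] inv span_neg by (auto simp: N_def)
  qed (use M.one_closed zero span_zero in \<open>auto simp: N_def\<close>)
  moreover have "a \<odot>\<^bsub>M\<^esub> x \<in> N" if "x \<in> N" for a x
    using that smult span_scale by (auto simp: N_def)
  ultimately have "submodule N mpoly_ring M"
    by (simp add: submodule_def submodule_axioms_def)
  moreover have "S \<subseteq> N" using S(1) by (auto simp: N_def intro: span_base)
  ultimately have "carrier M \<subseteq> N"
    using S(3) by (auto simp: generated_submodule_def)
  then have "\<psi> ` carrier M \<subseteq> span (\<psi> ` S)" by (auto simp: N_def)
  with E have sub: "monomial ` E \<subseteq> span (\<psi> ` S)" by (rule order_trans)
  have "independent (monomial ` E :: ('n, 'k) mpoly set)"
    unfolding dependent_explicit
  proof (safe)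
    fix t u v
    assume t: "finite t" "t \<subseteq> (monomial ` E :: ('n, 'k) mpoly set)" and v: "v \<in> t" "u v \<noteq> 0"
      and sum0: "(\<Sum>v\<in>t. Poly_Mapping.single 0 (u v) * v) = 0"
    obtain e where e: "v = monomial e" using t(2) v(1) by auto
    have "Poly_Mapping.lookup (Poly_Mapping.single 0 (u w) * w) e = (if w = v then u v else 0)" if "w \<in> t" for w
      using that t(2) e by (auto simp: monomial_def mult_single lookup_single when_def)
    then have "Poly_Mapping.lookup (\<Sum>v\<in>t. Poly_Mapping.single 0 (u v) * v) e = u v"
      using t(1) v(1) by (simp add: lookup_sum)
    with sum0 v(2) show False by simp
  qed
  then have "card (monomial ` E :: ('n, 'k) mpoly set) \<le> card (\<psi> ` S)"
    using independent_span_bound[OF _ _ sub] S(2) by blast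
  also have "\<dots> \<le> card S" by (rule card_image_le[OF S(2)])
  finally show ?thesis
    by (metis card_image inj_on_subset inj_monomial top_greatest)
qed

lemma generated_submodule_eq_carrier:
  assumes "group (add_monoid M)" "S \<subseteq> carrier M"
    and "\<And>a x. a \<in> carrier R \<Longrightarrow> x \<in> carrier M \<Longrightarrow> a \<odot>\<^bsub>M\<^esub> x \<in> carrier M"
    and "\<And>N. submodule N R M \<Longrightarrow> S \<subseteq> N \<Longrightarrow> carrier M \<subseteq> N"
  shows "generated_submodule R M S = carrier M"
proof -
  have "submodule (carrier M) R M"
    using group.subgroup_self[OF assms(1)] assms(3) by (simp add: submodule_def submodule_axioms_def)
  then show ?thesis using assms(2,4) by (auto simp: generated_submodule_def)
qed

text \<open>The elements \<open>g e\<close> give the upper bound, and they are distinct because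
  \<psi> separates them. The lower bound is \<open>card_le_card_generators\<close>.\<close>

lemma min_num_gens_eqI:
  fixes \<psi> :: "'b \<Rightarrow> ('n::finite, 'k::field) mpoly"
  assumes grp: "group (add_monoid M)"
    and add: "\<And>x y. x \<in> carrier M \<Longrightarrow> y \<in> carrier M \<Longrightarrow> \<psi> (x \<oplus>\<^bsub>M\<^esub> y) = \<psi> x + \<psi> y"
    and smult: "\<And>a x. x \<in> carrier M \<Longrightarrow> a \<odot>\<^bsub>M\<^esub> x \<in> carrier M \<and>
      \<psi> (a \<odot>\<^bsub>M\<^esub> x) = Poly_Mapping.single 0 (Poly_Mapping.lookup a 0) * \<psi> x"
    and E: "finite E" "g ` E \<subseteq> carrier M" "\<And>e. e \<in> E \<Longrightarrow> \<psi> (g e) = monomial e"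
    and gen: "\<And>N. submodule N mpoly_ring M \<Longrightarrow> g ` E \<subseteq> N \<Longrightarrow> carrier M \<subseteq> N"
  shows "min_num_gens mpoly_ring M = card E"
  unfolding min_num_gens_def
proof (rule Least_equality)
  have "inj_on g E"
    using E(3) inj_monomial by (metis inj_onI injD)
  then show "\<exists>S\<subseteq>carrier M. finite S \<and> card S = card E \<and> generated_submodule mpoly_ring M S = carrier M"
    using E smult gen
    by (intro exI[of _ "g ` E"] conjI generated_submodule_eq_carrier[OF grp])
      (auto simp: card_image)
  fix m
  assume "\<exists>S\<subseteq>carrier M. finite S \<and> card S = m \<and> generated_submodule mpoly_ring M S = carrier M"
  moreover have "monomial ` E \<subseteq> \<psi> ` carrier M"
    using E(2,3) by (force simp: image_iff)
  ultimately show "card E \<le> m"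
    using card_le_card_generators[OF grp add smult] by blast
qed

text \<open>Projection onto the span of the monomials with exponent in \<open>E\<close>. When
  \<open>E\<close> consists of minimal exponents of \<open>U\<close>, it kills the product of
  \<open>monomial_ideal U\<close> with the ideal of all variables; this is the \<psi> required
  above.\<close>

definition restrict_keys :: "('n \<Rightarrow>\<^sub>0 nat) set \<Rightarrow> ('n::finite, 'k::field) mpoly \<Rightarrow> ('n, 'k) mpoly" where
  "restrict_keys E p = (\<Sum>e\<in>E. Poly_Mapping.single e (Poly_Mapping.lookup p e))"

lemma lookup_restrict_keys:
  "finite E \<Longrightarrow> Poly_Mapping.lookup (restrict_keys E p) e = (Poly_Mapping.lookup p e when e \<in> E)"
  by (simp add: restrict_keys_def lookup_sum lookup_single when_def)

lemma restrict_keys_add: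
  "finite E \<Longrightarrow> restrict_keys E (p + q) = restrict_keys E p + restrict_keys E q"
  by (rule poly_mapping_eqI) (simp add: lookup_restrict_keys lookup_add when_def)

lemma restrict_keys_monomial:
  "finite E \<Longrightarrow> e \<in> E \<Longrightarrow> restrict_keys E (monomial e) = monomial e"
  by (rule poly_mapping_eqI) (auto simp: lookup_restrict_keys monomial_def lookup_single when_def)

text \<open>A minimal exponent \<open>e\<close> splits as a sum with second summand in
  \<open>U\<close> only as 0 + \<open>e\<close>. Hence only the constant term of \<open>a\<close>
  contributes; \<open>b\<close> is \<open>a\<close> without that term.\<close>

lemma lookup_mult_minimal:
  fixes a p :: "('n::finite, 'k::field) mpoly"
  assumes e: "e \<in> minimal U" and p: "p \<in> monomial_ideal U"
  shows "Poly_Mapping.lookup (a * p) e = Poly_Mapping.lookup a 0 * Poly_Mapping.lookup p e"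
proof -
  define c where "c = Poly_Mapping.lookup a 0"
  define b where "b = a - Poly_Mapping.single 0 c"
  have "Poly_Mapping.lookup b 0 = 0" by (simp add: b_def c_def lookup_minus)
  then have b: "0 \<notin> Poly_Mapping.keys b" by (simp add: in_keys_iff)
  have "e \<notin> Poly_Mapping.keys (b * p)"
  proof
    assume "e \<in> Poly_Mapping.keys (b * p)"
    then obtain x y where xy: "x \<in> Poly_Mapping.keys b" "y \<in> Poly_Mapping.keys p" "e = x + y"
      using keys_mult_edvd by blast
    then have "y = e"
      using e p edvd_add(2)[of y x] unfolding minimal_def monomial_ideal_def by blast
    with xy(3) have "x + y = 0 + y" by simp
    then have "x = 0" by (rule add_right_imp_eq)
    with xy(1) b show False by simp
  qed
  then have "Poly_Mapping.lookup (b * p) e = 0" by (simp add: in_keys_iff)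
  moreover have "Poly_Mapping.lookup (Poly_Mapping.single 0 c * p) e = c * Poly_Mapping.lookup p e"
    by (simp flip: mult_map_scale_conv_mult add: Poly_Mapping.map.rep_eq when_def)
  moreover have "a * p = Poly_Mapping.single 0 c * p + b * p"
    by (simp add: b_def algebra_simps)
  ultimately show ?thesis by (simp add: lookup_add c_def)
qed

lemma restrict_keys_mult:
  fixes a p :: "('n::finite, 'k::field) mpoly"
  assumes "finite E" "E \<subseteq> minimal U" "p \<in> monomial_ideal U"
  shows "restrict_keys E (a * p) = Poly_Mapping.single 0 (Poly_Mapping.lookup a 0) * restrict_keys E p"
proof -
  have "Poly_Mapping.single 0 c * restrict_keys E p =
      (\<Sum>e\<in>E. Poly_Mapping.single e (c * Poly_Mapping.lookup p e))" for c
    by (simp add: restrict_keys_def sum_distrib_left mult_single)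
  then show ?thesis
    using assms lookup_mult_minimal[of _ U p a]
    by (auto simp: restrict_keys_def intro!: sum.cong)
qed

lemma min_num_gens_monomial_ideal:
  assumes U: "upset U" "finite (minimal U)"
  shows "min_num_gens mpoly_ring (ideal_module mpoly_ring (monomial_ideal U :: ('n::finite, 'k::field) mpoly set))
    = card (minimal U)"
proof (rule min_num_gens_eqI[where \<psi> = "restrict_keys (minimal U)" and g = monomial])
  have J: "ideal (monomial_ideal U :: ('n, 'k) mpoly set) mpoly_ring"
    by (rule ideal_monomial_ideal[OF U(1)])
  then show "group (add_monoid (ideal_module mpoly_ring (monomial_ideal U :: ('n, 'k) mpoly set)))"
    by (rule group_ideal_module)
  show "a \<odot>\<^bsub>ideal_module mpoly_ring (monomial_ideal U)\<^esub> x
      \<in> carrier (ideal_module mpoly_ring (monomial_ideal U)) \<and>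
      restrict_keys (minimal U) (a \<odot>\<^bsub>ideal_module mpoly_ring (monomial_ideal U)\<^esub> x) =
      Poly_Mapping.single 0 (Poly_Mapping.lookup a 0) * restrict_keys (minimal U) x"
    if "x \<in> carrier (ideal_module mpoly_ring (monomial_ideal U))" for a x :: "('n, 'k) mpoly"
    using that J restrict_keys_mult[OF U(2) order_refl, of x a]
    by (simp add: ideal_type_ring_iff)
  fix N assume N: "submodule N (mpoly_ring :: ('n, 'k) mpoly ring)
      (ideal_module mpoly_ring (monomial_ideal U))" "monomial ` minimal U \<subseteq> N"
  then interpret submodule N "mpoly_ring :: ('n, 'k) mpoly ring" "ideal_module mpoly_ring (monomial_ideal U)"
    by simp
  have "ideal N mpoly_ring"
    using one_closed m_closed smult_closed by (auto simp: ideal_type_ring_iff)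
  from monomial_ideal_up_subset[OF this N(2)]
  show "carrier (ideal_module mpoly_ring (monomial_ideal U)) \<subseteq> N"
    by (simp add: up_minimal U)
qed (use U in \<open>auto simp: restrict_keys_add restrict_keys_monomial minimal_def\<close>)

text \<open>Minimal generators with exponent in \<open>V\<close> vanish in the quotient; the classes
  of the others generate it and stay independent.\<close>

lemma min_num_gens_quotient_monomial_ideal:
  assumes U: "upset U" "finite (minimal U)" and V: "upset V" "V \<subseteq> U"
  shows "min_num_gens mpoly_ring (quotient_module
      (ideal_module mpoly_ring (monomial_ideal U :: ('n::finite, 'k::field) mpoly set)) (monomial_ideal V))
    = card (minimal U - V)"
proof -
  let ?J = "monomial_ideal U :: ('n, 'k) mpoly set"
  let ?N = "monomial_ideal V :: ('n, 'k) mpoly set"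
  let ?Q = "quotient_module (ideal_module mpoly_ring ?J) ?N"
  let ?E = "minimal U - V"
  have J: "ideal ?J mpoly_ring" and N: "ideal ?N mpoly_ring" "?N \<subseteq> ?J"
    using U V by (auto intro: ideal_monomial_ideal subsetD[OF monomial_ideal_mono])
  note Q = quotient_ideal_module_simps[OF J N]
  have J': "0 \<in> ?J" "\<And>a b. a \<in> ?J \<Longrightarrow> b \<in> ?J \<Longrightarrow> a + b \<in> ?J" "\<And>r a. a \<in> ?J \<Longrightarrow> r * a \<in> ?J"
    using J by (auto simp: ideal_type_ring_iff)
  \<comment> \<open>Evaluating on a chosen representative is harmless: two representatives differ by
    an element of \<open>?N\<close>, all of whose exponents lie in \<open>V\<close> and hence
    outside \<open>?E\<close>.\<close>
  define \<psi> where "\<psi> A = restrict_keys ?E (SOME x. x \<in> A)" for A :: "('n, 'k) mpoly set"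
  have \<psi>: "\<psi> (ideal_coset ?N x) = restrict_keys ?E x" for x
  proof -
    have "0 + x \<in> ideal_coset ?N x"
      using N(1) unfolding ideal_type_ring_iff ideal_coset_def by blast
    then have "(SOME y. y \<in> ideal_coset ?N x) \<in> ideal_coset ?N x" by (rule someI)
    then obtain n where n: "n \<in> ?N" "(SOME y. y \<in> ideal_coset ?N x) = n + x"
      by (auto simp: ideal_coset_def)
    have "restrict_keys ?E n = 0"
      using n(1) U(2) by (intro poly_mapping_eqI)
        (auto simp: lookup_restrict_keys monomial_ideal_def when_def in_keys_iff)
    then show ?thesis using n(2) U(2) by (simp add: \<psi>_def restrict_keys_add)
  qed
  show ?thesis
  proof (rule min_num_gens_eqI[where \<psi> = \<psi> and g = "\<lambda>e. ideal_coset ?N (monomial e)"])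
    show "group (add_monoid ?Q)" by (rule group_quotient_ideal_module[OF J N])
    show "\<psi> (A \<oplus>\<^bsub>?Q\<^esub> B) = \<psi> A + \<psi> B" if "A \<in> carrier ?Q" "B \<in> carrier ?Q" for A B
      using that U(2) by (auto simp: Q \<psi> restrict_keys_add)
    show "a \<odot>\<^bsub>?Q\<^esub> A \<in> carrier ?Q \<and>
        \<psi> (a \<odot>\<^bsub>?Q\<^esub> A) = Poly_Mapping.single 0 (Poly_Mapping.lookup a 0) * \<psi> A"
      if "A \<in> carrier ?Q" for a A
      using that U(2) J'(3) by (auto simp: Q \<psi> restrict_keys_mult[where U = U])
    fix L assume L: "submodule L mpoly_ring ?Q" "(\<lambda>e. ideal_coset ?N (monomial e)) ` ?E \<subseteq> L"
    then interpret submodule L mpoly_ring ?Q by simp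
    \<comment> \<open>The preimage of \<open>L\<close> in \<open>?J\<close> is an ideal. It contains
      every minimal generator: one with exponent in \<open>V\<close> is sent to the zero coset, the
      others to given generators of \<open>L\<close>.\<close>
    define K where "K = {x \<in> ?J. ideal_coset ?N x \<in> L}"
    have NL: "?N \<in> L" using one_closed by (simp add: Q)
    have "ideal K mpoly_ring"
      unfolding ideal_type_ring_iff K_def
      using NL m_closed smult_closed J' by (auto simp: ideal_coset_zero simp flip: Q(3,4))
    moreover have "monomial e \<in> K" if e: "e \<in> minimal U" for e
    proof (cases "e \<in> V")
      case True
      then have "ideal_coset ?N (monomial e) = ideal_coset ?N 0"
        by (simp add: ideal_coset_eq_iff[OF N(1)])
      then show ?thesis using NL e by (auto simp: K_def ideal_coset_zero minimal_def)
    next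
      case False
      then show ?thesis using L(2) e by (auto simp: K_def minimal_def)
    qed
    ultimately have "monomial_ideal (up (minimal U)) \<subseteq> K"
      by (intro monomial_ideal_up_subset) auto
    then show "carrier ?Q \<subseteq> L" by (auto simp: Q K_def up_minimal U)
  qed (use U in \<open>auto simp: Q \<psi> restrict_keys_monomial minimal_def\<close>)
qed

section \<open>Symbolic powers of cover ideals\<close>

definition wt :: "'n set \<Rightarrow> ('n::finite \<Rightarrow>\<^sub>0 nat) \<Rightarrow> nat" where
  "wt B k = (\<Sum>i\<in>B. Poly_Mapping.lookup k i)"

definition ind :: "'n set \<Rightarrow> ('n::finite \<Rightarrow>\<^sub>0 nat)" where
  "ind S = (\<Sum>i\<in>S. Poly_Mapping.single i 1)"

lemma wt_add: "wt B (a + b) = wt B a + wt B b"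
  by (simp add: wt_def lookup_add sum.distrib)

lemma wt_mono: "a \<preceq> b \<Longrightarrow> wt B a \<le> wt B b"
  by (simp add: wt_def edvd_def sum_mono)

lemma lookup_ind: "Poly_Mapping.lookup (ind S) i = (if i \<in> S then 1 else 0)"
  by (simp add: ind_def lookup_sum lookup_single when_def)

lemma wt_ind: "wt B (ind S) = card (B \<inter> S)"
  by (simp add: wt_def lookup_ind flip: sum.inter_restrict)

lemma wt_pos_iff: "Suc 0 \<le> wt B k \<longleftrightarrow> (\<exists>i\<in>B. Suc 0 \<le> Poly_Mapping.lookup k i)"
  by (simp add: wt_def Suc_le_eq flip: neq0_conv)

lemma wt_single: "wt B (Poly_Mapping.single i c) = (if i \<in> B then c else 0)"
  by (simp add: wt_def lookup_single when_def)

lemma single_edvd_iff: "Poly_Mapping.single i c \<preceq> k \<longleftrightarrow> c \<le> Poly_Mapping.lookup k i"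
  by (auto simp: edvd_def lookup_single when_def)

lemma upset_wt: "upset {k. \<forall>B\<in>\<B>. l \<le> wt B k}"
  unfolding upset_def by (auto intro: order_trans[OF _ wt_mono])

lemma upset_wt1: "upset {k. l \<le> wt B k}"
  using upset_wt[of "{B}" l] by simp

lemma var_prime_eq:
  "(var_prime B :: ('n::finite, 'k::field) mpoly set) = monomial_ideal {k. 1 \<le> wt B k}"
proof -
  have "var ` B = (monomial ` (\<lambda>i. Poly_Mapping.single i 1) ` B :: ('n, 'k) mpoly set)"
    by (auto simp: var_def)
  moreover have "up ((\<lambda>i. Poly_Mapping.single i 1) ` B) = {k. 1 \<le> wt B k}"
    by (auto simp: up_def wt_pos_iff single_edvd_iff)
  ultimately show ?thesis by (simp add: var_prime_def Idl_monomials)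
qed

text \<open>A monomial of degree at least l + 1 in the variables of \<open>B\<close> is divisible by
  one of these variables, and dividing by it leaves degree at least l.\<close>

lemma sumset_pow_wt: "sumset_pow {k. 1 \<le> wt B k} l = {k. l \<le> wt B k}"
proof (induction l)
  case (Suc l)
  show ?case
  proof (intro Set.set_eqI iffI)
    fix k assume "k \<in> sumset_pow {k. 1 \<le> wt B k} (Suc l)"
    then show "k \<in> {k. Suc l \<le> wt B k}"
      unfolding sumset_pow.simps Suc.IH by (auto simp: sumset_def wt_add)
  next
    fix k assume k: "k \<in> {k. Suc l \<le> wt B k}"
    then obtain i where i: "i \<in> B" "1 \<le> Poly_Mapping.lookup k i"
      using wt_pos_iff[of B k] by auto
    define d where "d = k - Poly_Mapping.single i 1"
    have kd: "k = d + Poly_Mapping.single i 1"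
      using edvd_diff_add[of "Poly_Mapping.single i 1" k] i(2)
      by (simp add: d_def single_edvd_iff add.commute)
    have "d \<in> {k. l \<le> wt B k}" "Poly_Mapping.single i 1 \<in> {k. 1 \<le> wt B k}"
      using k i(1) by (auto simp: kd wt_add wt_single)
    then show "k \<in> sumset_pow {k. 1 \<le> wt B k} (Suc l)"
      unfolding sumset_pow.simps Suc.IH sumset_def using kd by blast
  qed
qed simp

section \<open>Primeness of ideals generated by variables\<close>

text \<open>This replaces leading terms for a lexicographic order. Keeping only the exponents with
  maximal entry, one coordinate after the other, ends with a pair whose sum arises in one way; it
  provides a term that cannot cancel in a product.\<close>

lemma ex_unique_sum:
  fixes K L :: "('n::finite \<Rightarrow>\<^sub>0 nat) set"
  assumes "finite K" "K \<noteq> {}" "finite L" "L \<noteq> {}"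
  shows "\<exists>a\<in>K. \<exists>b\<in>L. \<forall>c\<in>K. \<forall>d\<in>L. c + d = a + b \<longrightarrow> c = a \<and> d = b"
proof -
  \<comment> \<open>\<open>closed\<close> says that a sum from \<open>K'\<close> and
    \<open>L'\<close> cannot be rewritten with summands of \<open>K\<close> and \<open>L\<close>
    outside \<open>K'\<close> and \<open>L'\<close>; \<open>agree V\<close> says that the
    coordinates in \<open>V\<close> are already constant.\<close>
  define closed where "closed K' L' \<longleftrightarrow>
    (\<forall>a\<in>K'. \<forall>b\<in>L'. \<forall>c\<in>K. \<forall>d\<in>L. c + d = a + b \<longrightarrow> c \<in> K' \<and> d \<in> L')" for K' L'
  define agree where "agree V K' \<longleftrightarrow>
    (\<forall>i\<in>V. \<forall>a\<in>K'. \<forall>c\<in>K'. Poly_Mapping.lookup a i = Poly_Mapping.lookup c i)"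
    for V and K' :: "('n \<Rightarrow>\<^sub>0 nat) set"
  have "\<exists>K' L'. K' \<subseteq> K \<and> K' \<noteq> {} \<and> L' \<subseteq> L \<and> L' \<noteq> {} \<and> closed K' L' \<and> agree V K' \<and> agree V L'"
    if "finite V" for V
    using that
  proof induction
    case empty
    show ?case using assms by (intro exI[of _ K] exI[of _ L]) (auto simp: closed_def agree_def)
  next
    case (insert v V)
    from insert.IH obtain K' L' where K': "K' \<subseteq> K" "K' \<noteq> {}" and L': "L' \<subseteq> L" "L' \<noteq> {}"
      and closed: "closed K' L'" and agree: "agree V K'" "agree V L'"
      by blast
    let ?f = "\<lambda>a. Poly_Mapping.lookup a v"
    have fin: "finite K'" "finite L'" using K' L' assms finite_subset by blast+
    define m n where "m = Max (?f ` K')" and "n = Max (?f ` L')"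
    have m: "m \<in> ?f ` K'" "\<And>a. a \<in> K' \<Longrightarrow> ?f a \<le> m"
      and n: "n \<in> ?f ` L'" "\<And>a. a \<in> L' \<Longrightarrow> ?f a \<le> n"
      using fin K'(2) L'(2) by (auto simp: m_def n_def)
    \<comment> \<open>The entries at \<open>v\<close> add up to \<open>m + n\<close> and are bounded
      by the maxima \<open>m\<close> and \<open>n\<close>, so both maxima are attained.\<close>
    have "c \<in> {a \<in> K'. ?f a = m} \<and> d \<in> {a \<in> L'. ?f a = n}"
      if "a \<in> K'" "?f a = m" "b \<in> L'" "?f b = n" "c \<in> K" "d \<in> L" "c + d = a + b" for a b c d
    proof -
      have cd: "c \<in> K'" "d \<in> L'" using closed that unfolding closed_def by blast+
      have "?f c + ?f d = m + n" using that by (metis lookup_add)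
      with m(2)[OF cd(1)] n(2)[OF cd(2)] cd show ?thesis by auto
    qed
    then have "closed {a \<in> K'. ?f a = m} {a \<in> L'. ?f a = n}"
      unfolding closed_def by blast
    moreover have "agree (insert v V) {a \<in> S. ?f a = k}" if "agree V S" for S k
      unfolding agree_def
    proof (intro ballI)
      fix i a c assume "i \<in> insert v V" "a \<in> {a \<in> S. ?f a = k}" "c \<in> {a \<in> S. ?f a = k}"
      then show "Poly_Mapping.lookup a i = Poly_Mapping.lookup c i"
        using that unfolding agree_def by (cases "i = v") (simp, blast)
    qed
    note this[OF agree(1), of m] this[OF agree(2), of n]
    moreover have "{a \<in> K'. ?f a = m} \<noteq> {}" "{a \<in> L'. ?f a = n} \<noteq> {}"
      using m(1) n(1) by auto
    moreover have "{a \<in> K'. ?f a = m} \<subseteq> K" "{a \<in> L'. ?f a = n} \<subseteq> L" using K' L' by auto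
    ultimately show ?case by blast
  qed
  \<comment> \<open>Once all coordinates are constant, both sets are singletons.\<close>
  from this[of UNIV] obtain K' L' where K': "K' \<subseteq> K" "K' \<noteq> {}" and L': "L' \<subseteq> L" "L' \<noteq> {}"
    and closed: "closed K' L'" and agree: "agree UNIV K'" "agree UNIV L'"
    by auto
  have eq: "a \<in> K' \<Longrightarrow> c \<in> K' \<Longrightarrow> c = a" "a \<in> L' \<Longrightarrow> c \<in> L' \<Longrightarrow> c = a" for a c
    using agree unfolding agree_def by (blast intro: poly_mapping_eqI)+
  obtain a b where ab: "a \<in> K'" "b \<in> L'" using K' L' by blast
  have "\<forall>c\<in>K. \<forall>d\<in>L. c + d = a + b \<longrightarrow> c = a \<and> d = b"
    using closed ab eq(1)[OF ab(1)] eq(2)[OF ab(2)] unfolding closed_def by blast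
  then show ?thesis using ab K'(1) L'(1) by blast
qed

lemma lookup_mult_keys:
  fixes p q :: "('n::finite, 'k::field) mpoly"
  shows "Poly_Mapping.lookup (p * q) e = (\<Sum>c\<in>Poly_Mapping.keys p. \<Sum>d\<in>Poly_Mapping.keys q.
    Poly_Mapping.lookup p c * Poly_Mapping.lookup q d when c + d = e)"
proof -
  have "p * q = (\<Sum>c\<in>Poly_Mapping.keys p. Poly_Mapping.single 0 (Poly_Mapping.lookup p c) * monomial c) *
    (\<Sum>d\<in>Poly_Mapping.keys q. Poly_Mapping.single 0 (Poly_Mapping.lookup q d) * monomial d)"
    by (simp flip: mpoly_eq_sum)
  also have "\<dots> = (\<Sum>c\<in>Poly_Mapping.keys p. \<Sum>d\<in>Poly_Mapping.keys q.
    Poly_Mapping.single (c + d) (Poly_Mapping.lookup p c * Poly_Mapping.lookup q d))"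
    by (simp add: monomial_def mult_single sum_product)
  finally show ?thesis by (simp add: lookup_sum lookup_single)
qed

text \<open>If neither factor lies in the ideal, both have terms free of the variables of
  \<open>B\<close>. A uniquely attained sum of two such exponents survives in the product and is
  again free of these variables.\<close>

lemma primeideal_wt:
  "primeideal (monomial_ideal {k. 1 \<le> wt B k} :: ('n::finite, 'k::field) mpoly set) mpoly_ring"
proof (rule primeidealI)
  show "ideal (monomial_ideal {k. 1 \<le> wt B k} :: ('n, 'k) mpoly set) mpoly_ring"
    by (rule ideal_monomial_ideal[OF upset_wt1])
  show "cring (mpoly_ring :: ('n, 'k) mpoly ring)" by rule
  have "monomial 0 \<notin> (monomial_ideal {k. 1 \<le> wt B k} :: ('n, 'k) mpoly set)"
    by (simp add: wt_def)
  then show "carrier mpoly_ring \<noteq> (monomial_ideal {k. 1 \<le> wt B k} :: ('n, 'k) mpoly set)"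
    by (metis UNIV_I type_ring_simps(1))
  fix p q :: "('n, 'k) mpoly"
  assume pq: "p \<otimes>\<^bsub>mpoly_ring\<^esub> q \<in> monomial_ideal {k. 1 \<le> wt B k}"
  show "p \<in> monomial_ideal {k. 1 \<le> wt B k} \<or> q \<in> monomial_ideal {k. 1 \<le> wt B k}"
  proof (rule ccontr)
    assume "\<not> ?thesis"
    then have ne: "{k \<in> Poly_Mapping.keys p. wt B k = 0} \<noteq> {}" "{k \<in> Poly_Mapping.keys q. wt B k = 0} \<noteq> {}"
      by (auto simp: monomial_ideal_def)
    have "finite {k \<in> Poly_Mapping.keys p. wt B k = 0}" "finite {k \<in> Poly_Mapping.keys q. wt B k = 0}"
      by auto
    with ne obtain a b where a: "a \<in> Poly_Mapping.keys p" "wt B a = 0"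
      and b: "b \<in> Poly_Mapping.keys q" "wt B b = 0"
      and uniq: "\<And>c d. c \<in> Poly_Mapping.keys p \<Longrightarrow> wt B c = 0 \<Longrightarrow> d \<in> Poly_Mapping.keys q \<Longrightarrow> wt B d = 0
        \<Longrightarrow> c + d = a + b \<Longrightarrow> c = a \<and> d = b"
      using ex_unique_sum[of "{k \<in> Poly_Mapping.keys p. wt B k = 0}" "{k \<in> Poly_Mapping.keys q. wt B k = 0}"]
      by blast
    have wab: "wt B (a + b) = 0" using a b by (simp add: wt_add)
    have "(Poly_Mapping.lookup p c * Poly_Mapping.lookup q d when c + d = a + b) =
        (if c = a then if d = b then Poly_Mapping.lookup p a * Poly_Mapping.lookup q b else 0 else 0)"
      if "c \<in> Poly_Mapping.keys p" "d \<in> Poly_Mapping.keys q" for c d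
    proof (cases "c + d = a + b")
      case True
      \<comment> \<open>Degrees in \<open>B\<close> add, so any pair with this sum consists of
        exponents of degree 0 in \<open>B\<close>, and uniqueness applies to it.\<close>
      then have "wt B c + wt B d = 0" using wab by (metis wt_add)
      then show ?thesis using uniq[of c d] that True by auto
    qed auto
    then have "Poly_Mapping.lookup (p * q) (a + b) = (\<Sum>c\<in>Poly_Mapping.keys p. \<Sum>d\<in>Poly_Mapping.keys q.
      (if c = a then if d = b then Poly_Mapping.lookup p a * Poly_Mapping.lookup q b else 0 else 0))"
      unfolding lookup_mult_keys by (intro sum.cong refl) auto
    also have "\<dots> = (\<Sum>c\<in>Poly_Mapping.keys p. if c = a then
        (\<Sum>d\<in>Poly_Mapping.keys q. if d = b then Poly_Mapping.lookup p a * Poly_Mapping.lookup q b else 0) else 0)"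
      by (intro sum.cong refl) simp
    also have "\<dots> = Poly_Mapping.lookup p a * Poly_Mapping.lookup q b"
      using a b by simp
    finally have "a + b \<in> Poly_Mapping.keys (p * q)"
      using a b by (simp add: in_keys_iff)
    then show False using pq wab by (auto simp: monomial_ideal_def)
  qed
qed

text \<open>If each \<open>J F\<close> had an element outside \<open>P\<close>, the product of these
  elements would lie in the intersection but not in \<open>P\<close>.\<close>

lemma primeideal_INT_subset:
  fixes P :: "'a::comm_ring_1 set"
  assumes P: "primeideal P ring_of_type_algebra" and fin: "finite \<F>"
    and id: "\<And>F. F \<in> \<F> \<Longrightarrow> ideal (J F) (ring_of_type_algebra :: 'a ring)"
    and sub: "(\<Inter>F\<in>\<F>. J F) \<subseteq> P"
  shows "\<exists>F\<in>\<F>. J F \<subseteq> P"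
proof (rule ccontr)
  interpret P: primeideal P "ring_of_type_algebra :: 'a ring" by (rule P)
  assume "\<not> ?thesis"
  then have non: "\<And>F. F \<in> \<F> \<Longrightarrow> \<exists>x\<in>J F. x \<notin> P" by blast
  have "\<exists>x. x \<notin> P \<and> (\<forall>F\<in>\<F>. x \<in> J F)"
    using fin non id
  proof (induction \<F> rule: finite_induct)
    \<comment> \<open>The empty product: \<open>P\<close> is proper, so something lies outside it.
      The lemma thereby also shows that the family is nonempty.\<close>
    case empty
    then show ?case using P.I_notcarr by auto
  next
    case (insert F \<F>)
    then obtain x where x: "x \<notin> P" "\<forall>F\<in>\<F>. x \<in> J F" by auto
    obtain y where y: "y \<in> J F" "y \<notin> P" using insert.prems(1) by blast
    have "x * y \<notin> P" using x(1) y(2) P.I_prime by auto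
    moreover have "x * y \<in> J F" using insert.prems(2)[of F] y(1) by (auto simp: ideal_type_ring_iff)
    moreover have "x * y \<in> J G" if "G \<in> \<F>" for G
    proof -
      have "y * x \<in> J G" using insert.prems(2)[of G] that x(2) by (auto simp: ideal_type_ring_iff)
      then show ?thesis by (simp add: mult.commute)
    qed
    ultimately show ?case by auto
  qed
  with sub show False by auto
qed

section \<open>Associated primes of cover ideals\<close>

lemma associated_primes_quotient_ring:
  fixes J :: "'a::comm_ring_1 set"
  assumes J: "ideal J (ring_of_type_algebra :: 'a ring)"
  shows "associated_primes ring_of_type_algebra (quotient_module
      (ideal_module ring_of_type_algebra (carrier ring_of_type_algebra)) J) =
    {P. primeideal P ring_of_type_algebra \<and> (\<exists>m. P = {a. a * m \<in> J})}"
proof -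
  have U: "ideal UNIV (ring_of_type_algebra :: 'a ring)" by (simp add: ideal_type_ring_iff)
  note Q = quotient_ideal_module_simps[OF U J subset_UNIV]
  have "ideal_coset J m = J \<longleftrightarrow> m \<in> J" for m
    using ideal_coset_eq_iff[OF J, of m 0] by (simp add: ideal_coset_zero)
  then show ?thesis by (simp add: associated_primes_def Q)
qed

text \<open>The annihilator of the class of \<open>m\<close> is the intersection of those
  \<open>?P B\<close> that do not contain \<open>m\<close>. If it is prime, it contains one of them
  and so equals it. Conversely, each \<open>?P B\<close> arises from the product of the variables
  outside \<open>B\<close>.\<close>

lemma associated_primes_cover_ideal:
  fixes \<B> :: "'n::finite set set"
  assumes anti: "\<forall>B\<in>\<B>. \<forall>C\<in>\<B>. B \<subseteq> C \<longrightarrow> B = C"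
  shows "associated_primes mpoly_ring (quotient_module (ideal_module mpoly_ring (carrier mpoly_ring))
      (monomial_ideal {k. \<forall>B\<in>\<B>. 1 \<le> wt B k} :: ('n, 'k::field) mpoly set)) =
    (\<lambda>B. monomial_ideal {k. 1 \<le> wt B k}) ` \<B>"
proof -
  let ?P = "\<lambda>B. monomial_ideal {k. 1 \<le> wt B k} :: ('n, 'k) mpoly set"
  let ?I = "monomial_ideal {k. \<forall>B\<in>\<B>. 1 \<le> wt B k} :: ('n, 'k) mpoly set"
  have I: "ideal ?I mpoly_ring" by (rule ideal_monomial_ideal[OF upset_wt])
  have I_INT: "x \<in> ?I \<longleftrightarrow> (\<forall>B\<in>\<B>. x \<in> ?P B)" for x
    by (auto simp: monomial_ideal_def)
  have P_mult: "a * m \<in> ?P B \<longleftrightarrow> a \<in> ?P B \<or> m \<in> ?P B" for a m B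
  proof -
    interpret primeideal "?P B" mpoly_ring by (rule primeideal_wt)
    show ?thesis using I_prime[of a m] I_l_closed[of m a] I_r_closed[of a m] by auto
  qed
  show ?thesis
    unfolding associated_primes_quotient_ring[OF I]
  proof (intro Set.set_eqI iffI)
    fix P assume "P \<in> {P. primeideal P mpoly_ring \<and> (\<exists>m. P = {a. a * m \<in> ?I})}"
    then obtain m where P: "primeideal P mpoly_ring" "P = {a. a * m \<in> ?I}" by blast
    define \<B>' where "\<B>' = {B \<in> \<B>. m \<notin> ?P B}"
    have P': "P = (\<Inter>B\<in>\<B>'. ?P B)"
      by (auto simp: P(2) I_INT P_mult \<B>'_def simp del: One_nat_def)
    then have "\<exists>B\<in>\<B>'. ?P B \<subseteq> P"
      using ideal_monomial_ideal[OF upset_wt1]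
      by (intro primeideal_INT_subset[OF P(1)]) auto
    then obtain B where "B \<in> \<B>'" "?P B \<subseteq> P" by blast
    then have "P = ?P B" "B \<in> \<B>" using P' by (auto simp: \<B>'_def)
    then show "P \<in> ?P ` \<B>" by blast
  next
    fix P assume "P \<in> ?P ` \<B>"
    then obtain B where B: "B \<in> \<B>" "P = ?P B" by blast
    \<comment> \<open>This monomial avoids \<open>?P C\<close> exactly when \<open>C\<close> is
      contained in \<open>B\<close>, which in an antichain means \<open>C\<close> =
      \<open>B\<close>.\<close>
    have mem: "monomial (ind (UNIV - B)) \<in> ?P C \<longleftrightarrow> C \<noteq> B" if "C \<in> \<B>" for C
    proof -
      have "monomial (ind (UNIV - B)) \<in> ?P C \<longleftrightarrow> \<not> C \<subseteq> B"
        by (auto simp: wt_pos_iff lookup_ind)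
      then show ?thesis using anti that B(1) by auto
    qed
    have "P = {a. a * monomial (ind (UNIV - B)) \<in> ?I}"
      using B mem by (auto simp: I_INT P_mult simp del: One_nat_def)
    moreover have "primeideal P mpoly_ring" unfolding B(2) by (rule primeideal_wt)
    ultimately show "P \<in> {P. primeideal P mpoly_ring \<and> (\<exists>m. P = {a. a * m \<in> ?I})}" by blast
  qed
qed

lemma symbolic_power_cover_ideal:
  fixes \<B> :: "'n::finite set set"
  assumes "\<forall>B\<in>\<B>. \<forall>C\<in>\<B>. B \<subseteq> C \<longrightarrow> B = C"
  shows "symbolic_power mpoly_ring (monomial_ideal {k. \<forall>B\<in>\<B>. 1 \<le> wt B k} :: ('n, 'k::field) mpoly set) l =
    monomial_ideal {k. \<forall>B\<in>\<B>. l \<le> wt B k}"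
  unfolding symbolic_power_def associated_primes_cover_ideal[OF assms]
  by (simp only: image_image ideal_power_monomial_ideal[OF upset_wt1] sumset_pow_wt INT_monomial_ideal)
    (auto intro: arg_cong[of _ _ monomial_ideal])

section \<open>Products of circuits\<close>

text \<open>Exponent of the product in which the squarefree monomial of each set \<open>C\<close>
  occurs \<open>m C\<close> times. Multiplicities are defined on all subsets; the restriction to
  circuits is imposed through \<open>support\<close>.\<close>

definition combo :: "('n::finite set \<Rightarrow> nat) \<Rightarrow> ('n \<Rightarrow>\<^sub>0 nat)" where
  "combo m = Abs_poly_mapping (\<lambda>i. \<Sum>C | i \<in> C. m C)"

definition support :: "('a \<Rightarrow> nat) \<Rightarrow> 'a set" where
  "support m = {C. m C \<noteq> 0}"

lemma lookup_combo: "Poly_Mapping.lookup (combo m) i = (\<Sum>C | i \<in> C. m C)"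
  by (simp add: combo_def)

lemma wt_combo: "wt B (combo m) = (\<Sum>C\<in>UNIV. m C * card (B \<inter> C))"
proof -
  have "wt B (combo m) = (\<Sum>i\<in>B. \<Sum>C\<in>UNIV. if i \<in> C then m C else 0)"
    by (simp add: wt_def lookup_combo sum.If_cases)
  also have "\<dots> = (\<Sum>C\<in>UNIV. \<Sum>i\<in>B. if i \<in> C then m C else 0)"
    by (rule sum.swap)
  also have "\<dots> = (\<Sum>C\<in>UNIV. m C * card (B \<inter> C))"
    by (intro sum.cong refl) (simp add: sum.If_cases mult.commute)
  finally show ?thesis .
qed

lemma lookup_combo_pos_iff: "1 \<le> Poly_Mapping.lookup (combo m) i \<longleftrightarrow> i \<in> \<Union>(support m)"
  by (auto simp: lookup_combo support_def Suc_le_eq simp flip: neq0_conv)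

lemma combo_update: "combo (m(C := Suc (m C))) = combo m + ind C"
proof (rule poly_mapping_eqI)
  fix i
  have "(\<Sum>D | i \<in> D. (m(C := Suc (m C))) D) = (\<Sum>D | i \<in> D. m D + (if D = C then 1 else 0))"
    by (intro sum.cong) auto
  then show "Poly_Mapping.lookup (combo (m(C := Suc (m C)))) i = Poly_Mapping.lookup (combo m + ind C) i"
    by (simp add: lookup_combo lookup_add lookup_ind sum.distrib)
qed

lemma sum_update: "(\<Sum>D\<in>UNIV. (m(C := Suc (m C))) D) = Suc (\<Sum>D\<in>(UNIV :: 'a::finite set). m D)"
proof -
  have "(\<Sum>D\<in>UNIV. (m(C := Suc (m C))) D) = (\<Sum>D\<in>UNIV. m D + (if D = C then 1 else 0))"
    by (intro sum.cong) auto
  then show ?thesis by (simp add: sum.distrib)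
qed

text \<open>
  \<open>\<B>\<close> plays the role of the bases of the dual matroid, so that \<open>covers\<close> are the dependent sets of
  the matroid itself and \<open>circuits\<close> its circuits.
\<close>

locale cobases =
  fixes \<B> :: "'n::finite set set"
  assumes nonempty: "\<B> \<noteq> {}"
    and antichain: "\<forall>B\<in>\<B>. \<forall>C\<in>\<B>. B \<subseteq> C \<longrightarrow> B = C"
    and exchange: "B \<in> \<B> \<Longrightarrow> B' \<in> \<B> \<Longrightarrow> i \<in> B' - B \<Longrightarrow> \<exists>j\<in>B - B'. insert i (B - {j}) \<in> \<B>"
begin

definition covers :: "'n set set" where
  "covers = {C. \<forall>B\<in>\<B>. B \<inter> C \<noteq> {}}"

definition circuits :: "'n set set" where
  "circuits = {C \<in> covers. \<forall>D. D \<subset> C \<longrightarrow> D \<notin> covers}"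

definition symb :: "nat \<Rightarrow> ('n \<Rightarrow>\<^sub>0 nat) set" where
  "symb l = {k. \<forall>B\<in>\<B>. l \<le> wt B k}"

definition pow :: "nat \<Rightarrow> ('n \<Rightarrow>\<^sub>0 nat) set" where
  "pow l = sumset_pow (symb 1) l"

text \<open>The condition on the set of circuits occurring in a product that makes the product a
  minimal generator of the symbolic power. The empty set is good and accounts for the empty
  product.\<close>

definition good :: "'n set set \<Rightarrow> bool" where
  "good D \<longleftrightarrow> D \<subseteq> circuits \<and> (\<forall>i\<in>\<Union>D. \<exists>B\<in>\<B>. i \<in> B \<and> (\<forall>C\<in>D. card (B \<inter> C) = 1))"

lemma circuit_card: "C \<in> circuits \<Longrightarrow> B \<in> \<B> \<Longrightarrow> 1 \<le> card (B \<inter> C)"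
  by (auto simp: circuits_def covers_def Suc_le_eq card_gt_0_iff)

lemma circuit_nonempty: "C \<in> circuits \<Longrightarrow> C \<noteq> {}"
  using nonempty by (auto simp: circuits_def covers_def)

lemma cover_contains_circuit: "C \<in> covers \<Longrightarrow> \<exists>D\<in>circuits. D \<subseteq> C"
proof (induction "card C" arbitrary: C rule: less_induct)
  case less
  show ?case
  proof (cases "C \<in> circuits")
    case False
    then obtain D where D: "D \<subset> C" "D \<in> covers" using less.prems by (auto simp: circuits_def)
    then obtain E where "E \<in> circuits" "E \<subseteq> D"
      using less.hyps[of D] psubset_card_mono[of C D] by auto
    then show ?thesis using D(1) by blast
  qed auto
qed

text \<open>
  This is the uniqueness of the circuit inside a basis together with one more element \<open>b\<close>.
\<close>

lemma fundamental_circuit_unique: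
  assumes C: "C \<in> circuits" "C' \<in> circuits" and B: "B \<in> \<B>" "B \<inter> C = {b}" "B \<inter> C' = {b}"
  shows "C = C'"
proof (rule ccontr)
  assume "C \<noteq> C'"
  then have "\<not> C \<subseteq> C'" using C by (auto simp: circuits_def)
  then obtain c where c: "c \<in> C" "c \<notin> C'" by blast
  have b: "b \<in> B" "b \<in> C" "b \<in> C'" "c \<notin> B" "c \<noteq> b" using B c by auto
  \<comment> \<open>Since \<open>C\<close> is a minimal cover, some cobase avoids
    \<open>C - {c}\<close>. Among these cobases one is taken with as few elements outside
    \<open>B\<close> as possible.\<close>
  define \<A> where "\<A> = {A \<in> \<B>. A \<inter> (C - {c}) = {}}"
  have "C - {c} \<notin> covers" using C(1) c(1) by (auto simp: circuits_def)
  then have "\<exists>A. A \<in> \<A>" by (auto simp: covers_def \<A>_def)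
  then obtain A where A: "A \<in> \<A>" and least: "\<And>A'. A' \<in> \<A> \<Longrightarrow> card (A - B) \<le> card (A' - B)"
    using ex_has_least_nat[of "\<lambda>A. A \<in> \<A>" _ "\<lambda>A. card (A - B)"] by blast
  have AB: "A \<in> \<B>" "A \<inter> (C - {c}) = {}" using A by (auto simp: \<A>_def)
  have sub: "B - A \<subseteq> {b}"
  proof
    fix i assume i: "i \<in> B - A"
    show "i \<in> {b}"
    proof (rule ccontr)
      assume "i \<notin> {b}"
      then have "i \<notin> C" using i B(2) by blast
      \<comment> \<open>Exchanging into \<open>A\<close> an element of \<open>B\<close> that is not
        in \<open>C\<close> would stay in \<A> and come closer to \<open>B\<close>. Hence
        \<open>B - A\<close> contains at most \<open>b\<close>.\<close>
      obtain j where j: "j \<in> A - B" "insert i (A - {j}) \<in> \<B>"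
        using exchange[OF AB(1) B(1) i] by blast
      then have "insert i (A - {j}) \<in> \<A>" using AB(2) \<open>i \<notin> C\<close> by (auto simp: \<A>_def)
      from least[OF this] have "card (A - B) \<le> card (A - B - {j})"
        using i by (metis DiffD1 Diff_insert2 Diff_insert_absorb insert_Diff_if Diff_insert)
      moreover have "card (A - B - {j}) < card (A - B)" using j(1) by (intro psubset_card_mono) auto
      ultimately show False by simp
    qed
  qed
  have "b \<in> B - A" using b AB(2) by auto
  from exchange[OF AB(1) B(1) this] obtain j where j: "j \<in> A - B" "insert b (A - {j}) \<in> \<B>" by blast
  have "B \<subseteq> insert b (A - {j})" using sub j(1) by auto
  then have eq: "B = insert b (A - {j})" using antichain B(1) j(2) by blast
  \<comment> \<open>\<open>A\<close> can meet \<open>C\<close> only in \<open>c\<close>, so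
    \<open>c\<close> is the element exchanged for \<open>b\<close>. Then \<open>A\<close> arises
    from \<open>B\<close> by replacing \<open>b\<close> with \<open>c\<close> and misses
    \<open>C'\<close>, which is impossible for a cover.\<close>
  have "A \<inter> C \<noteq> {}" using C(1) AB(1) by (auto simp: circuits_def covers_def)
  then have "c \<in> A" using AB(2) by blast
  then have "c = j" using eq b by blast
  then have "A \<subseteq> insert c B" using eq by auto
  moreover have "c \<notin> C'" "b \<notin> A" "B \<inter> C' \<subseteq> {b}" using c(2) B(3) \<open>b \<in> B - A\<close> by auto
  ultimately have "A \<inter> C' = {}" by auto
  then show False using C(2) AB(1) by (auto simp: circuits_def covers_def)
qed

text \<open>At a common element \<open>i\<close>, goodness gives one cobase through \<open>i\<close>
  that meets both circuits exactly in \<open>i\<close>; fundamental circuits are unique.\<close>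

lemma good_disjoint:
  assumes "good D" "C \<in> D" "C' \<in> D" "i \<in> C" "i \<in> C'"
  shows "C = C'"
proof -
  obtain B where B: "B \<in> \<B>" "i \<in> B" "card (B \<inter> C) = 1" "card (B \<inter> C') = 1"
    using assms unfolding good_def by blast
  then have "B \<inter> C = {i}" "B \<inter> C' = {i}"
    using assms(4,5) by (metis IntI card_1_singletonE singletonD)+
  moreover have "C \<in> circuits" "C' \<in> circuits" using assms(1-3) by (auto simp: good_def)
  ultimately show ?thesis using fundamental_circuit_unique B(1) by blast
qed

text \<open>Minimality means that no single variable can be divided out. Dividing by the variable of
  \<open>i\<close> lowers the degree only on cobases through \<open>i\<close>, so it is blocked
  exactly by such a cobase with degree \<open>l\<close>.\<close>

lemma minimal_symb_iff:
  "k \<in> minimal (symb l) \<longleftrightarrow>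
    k \<in> symb l \<and> (\<forall>i. 1 \<le> Poly_Mapping.lookup k i \<longrightarrow> (\<exists>B\<in>\<B>. i \<in> B \<and> wt B k = l))"
proof (intro iffI conjI allI impI)
  assume k: "k \<in> minimal (symb l)"
  then show ks: "k \<in> symb l" by (simp add: minimal_def)
  fix i assume i: "1 \<le> Poly_Mapping.lookup k i"
  define d where "d = k - Poly_Mapping.single i 1"
  have kd: "k = d + Poly_Mapping.single i 1"
    using edvd_diff_add[of "Poly_Mapping.single i 1" k] i by (simp add: d_def single_edvd_iff add.commute)
  have "Poly_Mapping.lookup d i < Poly_Mapping.lookup k i" using i by (simp add: d_def lookup_minus)
  then have "d \<noteq> k" by auto
  then have "d \<notin> symb l" using k edvd_single_diff[of k i 1] by (auto simp: minimal_def d_def)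
  then obtain B where B: "B \<in> \<B>" "wt B d < l" by (auto simp: symb_def not_le)
  moreover have "l \<le> wt B k" using ks B(1) by (simp add: symb_def)
  \<comment> \<open>The degree falls from at least \<open>l\<close> to below \<open>l\<close> by a
    step of at most one; hence \<open>i\<close> lies in \<open>B\<close> and the degree was exactly
    \<open>l\<close>.\<close>
  moreover have "wt B k = wt B d + (if i \<in> B then 1 else 0)" by (simp add: kd wt_add wt_single)
  ultimately show "\<exists>B\<in>\<B>. i \<in> B \<and> wt B k = l" by (intro bexI[of _ B]) (auto split: if_splits)
next
  assume k: "k \<in> symb l \<and> (\<forall>i. 1 \<le> Poly_Mapping.lookup k i \<longrightarrow> (\<exists>B\<in>\<B>. i \<in> B \<and> wt B k = l))"
  have "a = k" if a: "a \<in> symb l" "a \<preceq> k" for a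
  proof (rule ccontr)
    assume "a \<noteq> k"
    then obtain i where i: "Poly_Mapping.lookup a i < Poly_Mapping.lookup k i"
      using a(2) by (metis edvd_def poly_mapping_eqI le_neq_implies_less)
    then have "1 \<le> Poly_Mapping.lookup k i" by simp
    then obtain B where B: "B \<in> \<B>" "i \<in> B" "wt B k = l" using k by blast
    have "wt B a < wt B k" unfolding wt_def
      using B(2) i a(2) by (intro sum_strict_mono_ex1) (auto simp: edvd_def)
    then show False using a(1) B by (auto simp: symb_def)
  qed
  with k show "k \<in> minimal (symb l)" by (auto simp: minimal_def)
qed

lemma upset_symb: "upset (symb l)"
  unfolding symb_def by (rule upset_wt)

text \<open>A cobase of degree \<open>l\<close> through \<open>i\<close> bounds the exponent at
  \<open>i\<close> by \<open>l\<close>.\<close>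

lemma finite_minimal_symb: "finite (minimal (symb l))"
proof -
  have le: "Poly_Mapping.lookup k i \<le> l" if k: "k \<in> minimal (symb l)" for k i
  proof (cases "1 \<le> Poly_Mapping.lookup k i")
    case True
    then obtain B where "B \<in> \<B>" "i \<in> B" "wt B k = l" using k minimal_symb_iff by blast
    then show ?thesis using member_le_sum[of i B "Poly_Mapping.lookup k"] by (simp add: wt_def)
  qed auto
  have "Poly_Mapping.lookup ` minimal (symb l) \<subseteq> UNIV \<rightarrow>\<^sub>E {..l}"
    using le by (auto simp: PiE_def)
  then have "finite (Poly_Mapping.lookup ` minimal (symb l))"
    by (rule finite_subset) (intro finite_PiE, auto)
  then show ?thesis
    by (rule finite_imageD) (auto simp: inj_on_def)
qed

text \<open>Every circuit meets every cobase at least once, so each factor adds at least one to the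
  degree. The total is minimal iff each circuit that occurs adds exactly one.\<close>

lemma wt_combo_circuits:
  assumes m: "support m \<subseteq> circuits" and B: "B \<in> \<B>"
  shows "(\<Sum>C\<in>UNIV. m C) \<le> wt B (combo m)"
    and "wt B (combo m) = (\<Sum>C\<in>UNIV. m C) \<longleftrightarrow> (\<forall>C\<in>support m. card (B \<inter> C) = 1)"
proof -
  have le: "m C \<le> m C * card (B \<inter> C)" for C
    using circuit_card[OF _ B, of C] m by (cases "m C = 0") (auto simp: support_def)
  then show "(\<Sum>C\<in>UNIV. m C) \<le> wt B (combo m)" by (auto simp: wt_combo intro: sum_mono)
  show "wt B (combo m) = (\<Sum>C\<in>UNIV. m C) \<longleftrightarrow> (\<forall>C\<in>support m. card (B \<inter> C) = 1)"
  proof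
    assume eq: "wt B (combo m) = (\<Sum>C\<in>UNIV. m C)"
    have "m C = m C * card (B \<inter> C)" for C
    proof (rule ccontr)
      assume "m C \<noteq> m C * card (B \<inter> C)"
      with le[of C] have "m C < m C * card (B \<inter> C)" by simp
      then have "(\<Sum>C\<in>UNIV. m C) < wt B (combo m)"
        unfolding wt_combo using le by (intro sum_strict_mono_ex1) auto
      with eq show False by simp
    qed
    then show "\<forall>C\<in>support m. card (B \<inter> C) = 1"
      by (metis (mono_tags, lifting) mem_Collect_eq mult_cancel1 nat_mult_1_right support_def)
  next
    assume "\<forall>C\<in>support m. card (B \<inter> C) = 1"
    then show "wt B (combo m) = (\<Sum>C\<in>UNIV. m C)"
      unfolding wt_combo by (intro sum.cong refl) (auto simp: support_def)
  qed
qed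

text \<open>Here the multiplicities drop out: both the variables that occur and the cobases with
  minimal degree depend only on the support.\<close>

lemma combo_in_minimal_symb_iff:
  assumes "support m \<subseteq> circuits"
  shows "combo m \<in> minimal (symb (\<Sum>C\<in>UNIV. m C)) \<longleftrightarrow> good (support m)"
proof -
  have "combo m \<in> symb (\<Sum>C\<in>UNIV. m C)"
    using wt_combo_circuits(1)[OF assms] by (auto simp: symb_def)
  then show ?thesis
    using assms wt_combo_circuits(2)[OF assms]
    by (auto simp: minimal_symb_iff good_def lookup_combo_pos_iff simp del: One_nat_def)
qed

text \<open>The circuit monomials generate the cover ideal, so each further power contributes one
  more circuit factor.\<close>

lemma pow_eq: "pow l = up {combo m | m. support m \<subseteq> circuits \<and> (\<Sum>C\<in>UNIV. m C) = l}"
proof (induction l)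
  case 0
  have "k \<in> up {combo m | m. support m \<subseteq> circuits \<and> (\<Sum>C\<in>UNIV. m C) = 0}" for k
    unfolding up_def
    by (rule CollectI, rule bexI[of _ "combo (\<lambda>_. 0)"])
      (auto simp: edvd_def lookup_combo support_def intro!: exI[of _ "\<lambda>_. 0"])
  then show ?case by (auto simp: pow_def)
next
  case (Suc l)
  have step: "pow (Suc l) = sumset (pow l) (symb 1)" by (simp add: pow_def)
  show ?case
  proof (intro Set.set_eqI iffI)
    fix k assume "k \<in> pow (Suc l)"
    then obtain a u where k: "k = a + u" "a \<in> pow l" "u \<in> symb 1" unfolding step sumset_def by blast
    from k(2) obtain m where m: "support m \<subseteq> circuits" "(\<Sum>C\<in>UNIV. m C) = l" "combo m \<preceq> a"
      unfolding Suc.IH up_def by blast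
    \<comment> \<open>The support of a monomial of the ideal meets every cobase and therefore
      contains a circuit.\<close>
    have "{i. 1 \<le> Poly_Mapping.lookup u i} \<in> covers"
      using k(3) by (auto simp: covers_def symb_def wt_pos_iff)
    then obtain C where C: "C \<in> circuits" "C \<subseteq> {i. 1 \<le> Poly_Mapping.lookup u i}"
      using cover_contains_circuit by blast
    then have "ind C \<preceq> u" by (auto simp: edvd_def lookup_ind)
    then have "combo (m(C := Suc (m C))) \<preceq> k"
      using m(3) unfolding combo_update k(1) by (auto simp: edvd_def lookup_add intro: add_mono)
    moreover have "support (m(C := Suc (m C))) \<subseteq> circuits" using m(1) C(1) by (auto simp: support_def)
    moreover have "(\<Sum>D\<in>UNIV. (m(C := Suc (m C))) D) = Suc l" unfolding sum_update m(2) ..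
    ultimately show "k \<in> up {combo m | m. support m \<subseteq> circuits \<and> (\<Sum>C\<in>UNIV. m C) = Suc l}"
      unfolding up_def by blast
  next
    fix k assume "k \<in> up {combo m | m. support m \<subseteq> circuits \<and> (\<Sum>C\<in>UNIV. m C) = Suc l}"
    then obtain m where m: "support m \<subseteq> circuits" "(\<Sum>C\<in>UNIV. m C) = Suc l" "combo m \<preceq> k"
      unfolding up_def by blast
    then obtain C where C: "m C \<noteq> 0" by (metis sum.neutral nat.distinct(1))
    \<comment> \<open>One copy of an occurring circuit is removed; \<open>m C\<close> is nonzero, so
      the subtraction is exact.\<close>
    define m' where "m' = m(C := m C - 1)"
    have m': "m = m'(C := Suc (m' C))" using C by (auto simp: m'_def)
    have "(\<Sum>D\<in>UNIV. m' D) = l" using m(2) sum_update[of m' C] m' by simp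
    moreover have Cc: "C \<in> circuits" using m(1) C by (auto simp: support_def)
    then have "support m' \<subseteq> circuits" using m(1) by (auto simp: support_def m'_def split: if_splits)
    ultimately have "combo m' \<in> pow l"
      unfolding Suc.IH by (intro subsetD[OF subset_up]) blast
    moreover from Cc have "ind C \<in> symb 1"
      using circuit_card by (auto simp: symb_def wt_ind)
    ultimately have "combo m' + ind C \<in> pow (Suc l)" unfolding step sumset_def by blast
    then have "combo m \<in> pow (Suc l)" using m' combo_update[of m' C] by simp
    then show "k \<in> pow (Suc l)" using m(3) upsetD[OF upset_sumset_pow] unfolding pow_def by blast
  qed
qed

lemma upset_pow: "upset (pow l)"
  by (simp add: pow_def upset_sumset_pow)

lemma pow_subset_symb: "pow l \<subseteq> symb l"
proof -
  have "combo m \<in> symb l" if "support m \<subseteq> circuits" "(\<Sum>C\<in>UNIV. m C) = l" for m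
    using wt_combo_circuits(1)[OF that(1)] that(2) by (auto simp: symb_def)
  then show ?thesis unfolding pow_eq up_def using upsetD[OF upset_symb] by blast
qed

text \<open>A product of \<open>l\<close> circuits already lies in the symbolic power, so a minimal
  generator divisible by it equals it.\<close>

lemma minimal_symb_Int_pow:
  "minimal (symb l) \<inter> pow l = combo ` {m. good (support m) \<and> (\<Sum>C\<in>UNIV. m C) = l}"
proof (intro equalityI subsetI)
  fix k assume k: "k \<in> minimal (symb l) \<inter> pow l"
  then obtain m where m: "support m \<subseteq> circuits" "(\<Sum>C\<in>UNIV. m C) = l" "combo m \<preceq> k"
    unfolding pow_eq up_def by blast
  then have "combo m \<in> symb l" using wt_combo_circuits(1)[OF m(1)] by (auto simp: symb_def)
  then have "combo m = k" using k m(3) by (auto simp: minimal_def)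
  then show "k \<in> combo ` {m. good (support m) \<and> (\<Sum>C\<in>UNIV. m C) = l}"
    using k m combo_in_minimal_symb_iff[OF m(1)] by blast
next
  fix k assume "k \<in> combo ` {m. good (support m) \<and> (\<Sum>C\<in>UNIV. m C) = l}"
  then obtain m where m: "good (support m)" "(\<Sum>C\<in>UNIV. m C) = l" "k = combo m" by blast
  then have "support m \<subseteq> circuits" by (simp add: good_def)
  moreover from this have "combo m \<in> pow l"
    unfolding pow_eq using m(2) by (intro subsetD[OF subset_up]) blast
  ultimately show "k \<in> minimal (symb l) \<inter> pow l"
    using m combo_in_minimal_symb_iff[of m] by simp
qed

lemma lookup_combo_disjoint:
  assumes "good D" "support m \<subseteq> D" "C \<in> D" "i \<in> C"
  shows "Poly_Mapping.lookup (combo m) i = m C"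
proof -
  have "m C' = 0" if "i \<in> C'" "C' \<noteq> C" for C'
    using good_disjoint[OF assms(1,3), of C' i] that assms(2,4) by (auto simp: support_def)
  then have "(\<Sum>C | i \<in> C. m C) = (\<Sum>C'\<in>{C}. m C')"
    using assms(4) by (intro sum.mono_neutral_right) auto
  then show ?thesis by (simp add: lookup_combo)
qed

text \<open>Having minimal degree on a cobase is a property of the product, not of its
  factorization. So the union of the supports of two factorizations is again good, hence disjoint,
  and both multiplicities of a circuit equal the exponent of any of its variables.\<close>

lemma inj_on_combo: "inj_on combo {m. good (support m) \<and> (\<Sum>C\<in>UNIV. m C) = l}"
proof (rule inj_onI)
  fix m m' assume m: "m \<in> {m. good (support m) \<and> (\<Sum>C\<in>UNIV. m C) = l}"
    and m': "m' \<in> {m. good (support m) \<and> (\<Sum>C\<in>UNIV. m C) = l}" and eq: "combo m = combo m'"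
  define D where "D = support m \<union> support m'"
  have circ: "support m \<subseteq> circuits" "support m' \<subseteq> circuits" using m m' by (auto simp: good_def)
  have min: "combo m \<in> minimal (symb l)" using combo_in_minimal_symb_iff[OF circ(1)] m by auto
  have "good D"
    unfolding good_def
  proof (intro conjI ballI)
    show "D \<subseteq> circuits" using circ by (simp add: D_def)
    fix i assume "i \<in> \<Union>D"
    \<comment> \<open>The two products are equal, so an element covered by either support occurs in
      \<open>combo m\<close>.\<close>
    then have "1 \<le> Poly_Mapping.lookup (combo m) i"
      using lookup_combo_pos_iff[of m i] lookup_combo_pos_iff[of m' i] by (auto simp: D_def eq)
    then obtain B where B: "B \<in> \<B>" "i \<in> B" "wt B (combo m) = l" using min minimal_symb_iff by blast
    then have "\<forall>C\<in>support m. card (B \<inter> C) = 1" "\<forall>C\<in>support m'. card (B \<inter> C) = 1"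
      using wt_combo_circuits(2)[OF circ(1) B(1)] wt_combo_circuits(2)[OF circ(2) B(1)] m m' eq by auto
    then show "\<exists>B\<in>\<B>. i \<in> B \<and> (\<forall>C\<in>D. card (B \<inter> C) = 1)" using B by (auto simp: D_def)
  qed
  show "m = m'"
  proof
    fix C
    show "m C = m' C"
    proof (cases "C \<in> D")
      case True
      then have "C \<in> circuits" using circ by (auto simp: D_def)
      then obtain i where "i \<in> C" using circuit_nonempty by blast
      then show ?thesis
        using lookup_combo_disjoint[OF \<open>good D\<close> _ True, of m i]
          lookup_combo_disjoint[OF \<open>good D\<close> _ True, of m' i] eq by (auto simp: D_def)
    qed (auto simp: D_def support_def)
  qed
qed

text \<open>For disjoint circuits the multiplicities are exponents, so a squarefree product uses
  each circuit at most once and is encoded by its support. The indicator \<chi> turns a good set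
  back into multiplicities.\<close>

lemma card_squarefree_minimal_symb_Int_pow:
  "card {k \<in> minimal (symb r) \<inter> pow r. \<forall>i. Poly_Mapping.lookup k i \<le> 1} = card {D. good D \<and> card D = r}"
proof -
  define \<chi> :: "'n set set \<Rightarrow> 'n set \<Rightarrow> nat" where "\<chi> D C = (if C \<in> D then 1 else 0)" for D C
  have \<chi>: "support (\<chi> D) = D" "(\<Sum>C\<in>UNIV. \<chi> D C) = card D" for D
    by (simp_all add: support_def \<chi>_def sum.If_cases)
  have le1: "m = \<chi> (support m)" if "good (support m)" "\<forall>i. Poly_Mapping.lookup (combo m) i \<le> 1" for m
  proof
    fix C
    show "m C = \<chi> (support m) C"
    proof (cases "C \<in> support m")
      case True
      then have "C \<in> circuits" using that(1) by (auto simp: good_def)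
      then obtain i where i: "i \<in> C" using circuit_nonempty by blast
      have "m C \<le> 1" using lookup_combo_disjoint[OF that(1) order_refl True i] that(2) by metis
      then show ?thesis using True by (auto simp: \<chi>_def support_def)
    qed (auto simp: \<chi>_def support_def)
  qed
  have le1': "Poly_Mapping.lookup (combo (\<chi> D)) i \<le> 1" if "good D" for D i
  proof (cases "i \<in> \<Union>D")
    case True
    then show ?thesis using lookup_combo_disjoint[OF that, of "\<chi> D" _ i] by (auto simp: \<chi>(1)) (simp add: \<chi>_def)
  next
    case False
    then show ?thesis using lookup_combo_pos_iff[of "\<chi> D" i] by (simp add: \<chi>(1))
  qed
  have "{k \<in> minimal (symb r) \<inter> pow r. \<forall>i. Poly_Mapping.lookup k i \<le> 1} =
    (\<lambda>D. combo (\<chi> D)) ` {D. good D \<and> card D = r}" (is "?L = ?R")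
  proof (intro equalityI subsetI)
    fix k assume "k \<in> ?L"
    then obtain m where m: "good (support m)" "(\<Sum>C\<in>UNIV. m C) = r" "k = combo m"
      "\<forall>i. Poly_Mapping.lookup (combo m) i \<le> 1"
      unfolding minimal_symb_Int_pow by blast
    have "m = \<chi> (support m)" by (rule le1[OF m(1,4)])
    then show "k \<in> ?R" using m \<chi>(2)[of "support m"] by (intro image_eqI[of _ _ "support m"]) auto
  next
    fix k assume "k \<in> ?R"
    then show "k \<in> ?L" unfolding minimal_symb_Int_pow using \<chi> le1' by auto
  qed
  moreover have "inj_on (\<lambda>D. combo (\<chi> D)) {D. good D \<and> card D = r}"
  proof (rule inj_onI)
    fix D D' assume "D \<in> {D. good D \<and> card D = r}" "D' \<in> {D. good D \<and> card D = r}"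
      "combo (\<chi> D) = combo (\<chi> D')"
    then have "\<chi> D = \<chi> D'" by (intro inj_onD[OF inj_on_combo[of r]]) (auto simp: \<chi>)
    then show "D = D'" by (metis \<chi>(1))
  qed
  ultimately show ?thesis by (simp add: card_image)
qed

end

section \<open>Counting compositions with a given support\<close>

text \<open>Stars and bars: subtracting 1 from every part leaves a list of \<open>card D\<close>
  naturals with sum \<open>l - card D\<close>.\<close>

lemma card_compositions:
  fixes D :: "'a::finite set"
  assumes "D \<noteq> {}" "1 \<le> l"
  shows "card {m. support m = D \<and> (\<Sum>x\<in>UNIV. m x) = l} =
    (if card D \<le> l then (l - 1) choose (l - card D) else 0)"
proof -
  obtain xs where xs: "set xs = D" "distinct xs" using finite_distinct_list[of D] by auto
  have len: "length xs = card D" using xs distinct_card by metis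
  have dpos: "0 < card D" using assms(1) by (simp add: card_gt_0_iff)
  have sumD: "(\<Sum>x\<in>UNIV. m x) = (\<Sum>x\<in>D. m x)" if "support m = D" for m :: "'a \<Rightarrow> nat"
    using that by (intro sum.mono_neutral_right) (auto simp: support_def)
  have sum1: "(\<Sum>x\<in>D. m x) = (\<Sum>x\<in>D. m x - 1) + card D" if "support m = D" for m :: "'a \<Rightarrow> nat"
  proof -
    have "(\<Sum>x\<in>D. m x) = (\<Sum>x\<in>D. (m x - 1) + 1)" using that by (intro sum.cong) (auto simp: support_def)
    then show ?thesis by (simp only: sum.distrib) simp
  qed
  show ?thesis
  proof (cases "card D \<le> l")
    case False
    then have none: "{m. support m = D \<and> (\<Sum>x\<in>UNIV. m x) = l} = {}"
      using sumD sum1 by fastforce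
    show ?thesis unfolding none using False by simp
  next
    case True
    let ?f = "\<lambda>m. map (\<lambda>x. m x - 1) xs"
    have "bij_betw ?f {m. support m = D \<and> (\<Sum>x\<in>UNIV. m x) = l}
      {ys. length ys = card D \<and> sum_list ys = l - card D}"
      unfolding bij_betw_def
    proof (intro conjI equalityI subsetI inj_onI)
      fix m m' assume m: "m \<in> {m. support m = D \<and> (\<Sum>x\<in>UNIV. m x) = l}"
        and m': "m' \<in> {m. support m = D \<and> (\<Sum>x\<in>UNIV. m x) = l}" and eq: "?f m = ?f m'"
      show "m = m'"
      proof
        fix x
        show "m x = m' x"
        proof (cases "x \<in> D")
          case True
          then have "m x - 1 = m' x - 1" using eq xs(1) by auto
          moreover have "x \<in> support m" "x \<in> support m'" using m m' True by auto
          then have "m x \<noteq> 0" "m' x \<noteq> 0" by (simp_all add: support_def)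
          ultimately show ?thesis by simp
        next
          case False
          then have "x \<notin> support m" "x \<notin> support m'" using m m' by auto
          then show ?thesis by (simp add: support_def)
        qed
      qed
    next
      fix ys assume "ys \<in> ?f ` {m. support m = D \<and> (\<Sum>x\<in>UNIV. m x) = l}"
      then obtain m where m: "support m = D" "(\<Sum>x\<in>UNIV. m x) = l" "ys = ?f m" by blast
      have "sum_list ys = (\<Sum>x\<in>D. m x - 1)" using m(3) xs by (simp add: sum_list_distinct_conv_sum_set)
      then show "ys \<in> {ys. length ys = card D \<and> sum_list ys = l - card D}"
        using sumD[OF m(1)] sum1[OF m(1)] m len by simp
    next
      fix ys :: "nat list" assume "ys \<in> {ys. length ys = card D \<and> sum_list ys = l - card D}"
      then have ys: "length ys = length xs" "sum_list ys = l - card D" by (auto simp: len)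
      \<comment> \<open>The inverse map: values on \<open>D\<close> are successors and the default
        outside is 0, so the support is exactly \<open>D\<close>.\<close>
      define m where "m x = (case map_of (zip xs ys) x of None \<Rightarrow> 0 | Some y \<Rightarrow> Suc y)" for x
      have mnth: "m (xs ! j) = Suc (ys ! j)" if "j < length xs" for j
        using that ys(1) xs(2) by (simp add: m_def map_of_zip_nth)
      have supp: "support m = D"
        using map_of_zip_is_None[OF ys(1)[symmetric]] xs(1) by (auto simp: support_def m_def split: option.splits)
      have f: "?f m = ys" using ys(1) mnth by (intro nth_equalityI) auto
      then have "(\<Sum>x\<in>D. m x - 1) = l - card D"
        using ys(2) xs by (metis sum_list_distinct_conv_sum_set)
      then have "(\<Sum>x\<in>UNIV. m x) = l" using sumD[OF supp] sum1[OF supp] True by simp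
      then show "ys \<in> ?f ` {m. support m = D \<and> (\<Sum>x\<in>UNIV. m x) = l}"
        using supp f by (intro image_eqI[of _ _ m]) auto
    qed
    then have "card {m. support m = D \<and> (\<Sum>x\<in>UNIV. m x) = l} =
        card {ys. length ys = card D \<and> sum_list ys = l - card D}" by (rule bij_betw_same_card)
    also have "\<dots> = (l - card D + card D - 1) choose (l - card D)" by (rule card_length_sum_list)
    finally show ?thesis using True by simp
  qed
qed

text \<open>Factorizations are sorted by support, and supports by size. The bound \<open>M\<close>
  only fixes the range of summation; it is later taken to be the monomial grade.\<close>

lemma (in cobases) card_minimal_symb_Int_pow:
  assumes l: "1 \<le> l" and M: "\<And>D. good D \<Longrightarrow> card D \<le> M"
  shows "card (minimal (symb l) \<inter> pow l) =
    (\<Sum>r = 1..M. card {D. good D \<and> card D = r} * (if r \<le> l then (l - 1) choose (l - r) else 0))"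
proof -
  define S where "S D = {m. support m = D \<and> (\<Sum>C\<in>UNIV. m C) = l}" for D :: "'n set set"
  define c where "c r = (if r \<le> l then (l - 1) choose (l - r) else 0)" for r
  have S: "card (S D) = c (card D)" if "D \<noteq> {}" for D
    unfolding S_def c_def by (rule card_compositions[OF that l])
  have fin: "finite (S D)" for D
  proof -
    have "m C \<le> (\<Sum>C\<in>UNIV. m C)" for m :: "'n set \<Rightarrow> nat" and C
      by (rule member_le_sum) auto
    then have "S D \<subseteq> UNIV \<rightarrow>\<^sub>E {..l}" by (auto simp: S_def PiE_def)
    then show ?thesis by (rule finite_subset) (intro finite_PiE, auto)
  qed
  \<comment> \<open>As \<open>l\<close> is positive, the empty support does not occur.\<close>
  have "{m. good (support m) \<and> (\<Sum>C\<in>UNIV. m C) = l} = (\<Union>D\<in>{D. good D \<and> D \<noteq> {}}. S D)"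
    using l by (auto simp: S_def support_def)
  then have "card (minimal (symb l) \<inter> pow l) = card (\<Union>D\<in>{D. good D \<and> D \<noteq> {}}. S D)"
    unfolding minimal_symb_Int_pow using card_image[OF inj_on_combo[of l]] by simp
  also have "\<dots> = (\<Sum>D\<in>{D. good D \<and> D \<noteq> {}}. card (S D))"
    using fin by (intro card_UN_disjoint) (auto simp: S_def)
  also have "\<dots> = (\<Sum>D\<in>{D. good D \<and> D \<noteq> {}}. c (card D))"
    by (intro sum.cong refl S) auto
  also have "\<dots> = (\<Sum>r = 1..M. \<Sum>D\<in>{D \<in> {D. good D \<and> D \<noteq> {}}. card D = r}. c (card D))"
    by (rule sum.group[symmetric]) (auto simp: M Suc_le_eq card_gt_0_iff)
  also have "\<dots> = (\<Sum>r = 1..M. card {D. good D \<and> card D = r} * c r)"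
  proof (intro sum.cong refl)
    fix r assume "r \<in> {1..M}"
    then have "{D \<in> {D. good D \<and> D \<noteq> {}}. card D = r} = {D. good D \<and> card D = r}" by auto
    then show "(\<Sum>D\<in>{D \<in> {D. good D \<and> D \<noteq> {}}. card D = r}. c (card D)) = card {D. good D \<and> card D = r} * c r"
      by simp
  qed
  finally show ?thesis by (simp add: c_def)
qed

section \<open>Regular sequences of monomials\<close>

lemma keys_monomial_mult: "k \<in> Poly_Mapping.keys g \<Longrightarrow> e + k \<in> Poly_Mapping.keys (monomial e * g)"
  for g :: "('n::finite, 'k::field) mpoly"
  by (simp add: in_keys_iff lookup_mult_keys) (simp add: monomial_def when_def in_keys_iff)

lemma regular_sequence_monomials_iff:
  "regular_sequence mpoly_ring (map monomial es :: ('n::finite, 'k::field) mpoly list) \<longleftrightarrow>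
    (\<forall>i<length es. \<forall>g :: ('n, 'k) mpoly. monomial (es ! i) * g \<in> monomial_ideal (up (set (take i es))) \<longrightarrow>
      g \<in> monomial_ideal (up (set (take i es)))) \<and> 0 \<notin> set es"
proof -
  have "(monomial_ideal (up (set es)) :: ('n, 'k) mpoly set) = UNIV \<longleftrightarrow> 0 \<in> set es"
  proof
    assume "(monomial_ideal (up (set es)) :: ('n, 'k) mpoly set) = UNIV"
    then have "(monomial 0 :: ('n, 'k) mpoly) \<in> monomial_ideal (up (set es))" by blast
    then obtain e where "e \<in> set es" "e \<preceq> 0" by (auto simp: up_def)
    moreover have "0 \<preceq> e" by (simp add: edvd_def)
    ultimately show "0 \<in> set es" using edvd_antisym by metis
  next
    assume "0 \<in> set es"
    moreover have "0 \<preceq> k" for k :: "'n \<Rightarrow>\<^sub>0 nat" by (simp add: edvd_def)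
    ultimately have "up (set es) = UNIV" unfolding up_def by blast
    then show "(monomial_ideal (up (set es)) :: ('n, 'k) mpoly set) = UNIV"
      by (simp add: monomial_ideal_def)
  qed
  then show ?thesis
    by (auto simp: regular_sequence_def take_map Idl_monomials)
qed

text \<open>Let the i-th and j-th monomials share a variable. Regularity puts the i-th one divided
  by this variable into the ideal of the monomials before j, so the k-th one divides it for some k <
  j. By induction the k-th and i-th are coprime, hence the k-th is 1, which a regular sequence
  excludes.\<close>

lemma regular_sequence_monomials_disjoint:
  assumes reg: "regular_sequence mpoly_ring (map monomial es :: ('n::finite, 'k::field) mpoly list)"
    and "i < j" "j < length es"
  shows "Poly_Mapping.lookup (es ! i) v = 0 \<or> Poly_Mapping.lookup (es ! j) v = 0"
  using assms(2,3)
proof (induction j arbitrary: i v rule: less_induct)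
  case (less j)
  have nz: "es ! k \<noteq> 0" if "k < length es" for k
    using reg that nth_mem[of k es] unfolding regular_sequence_monomials_iff by metis
  show ?case
  proof (rule ccontr)
    assume "\<not> ?case"
    then have v: "Poly_Mapping.lookup (es ! i) v \<noteq> 0" "Poly_Mapping.lookup (es ! j) v \<noteq> 0" by auto
    \<comment> \<open>The i-th monomial divided by the shared variable. Its product with the j-th
      one is a multiple of the i-th, since the j-th supplies that variable again.\<close>
    define d where "d = es ! i - Poly_Mapping.single v 1"
    have "es ! i \<preceq> es ! j + d"
      unfolding edvd_def
    proof
      fix w
      show "Poly_Mapping.lookup (es ! i) w \<le> Poly_Mapping.lookup (es ! j + d) w"
        using v by (cases "w = v") (auto simp: d_def lookup_add lookup_minus lookup_single)
    qed
    moreover have "es ! i \<in> set (take j es)"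
      using less.prems by (auto simp: in_set_conv_nth intro!: exI[of _ i])
    ultimately have "es ! j + d \<in> up (set (take j es))" by (auto simp: up_def)
    then have "monomial (es ! j) * (monomial d :: ('n, 'k) mpoly) \<in> monomial_ideal (up (set (take j es)))"
      by (simp flip: monomial_add)
    then have "(monomial d :: ('n, 'k) mpoly) \<in> monomial_ideal (up (set (take j es)))"
      using reg less.prems(2) unfolding regular_sequence_monomials_iff by blast
    then obtain k where k: "k < j" "es ! k \<preceq> d"
      using less.prems(2) by (auto simp: up_def in_set_conv_nth)
    have "Poly_Mapping.lookup d v < Poly_Mapping.lookup (es ! i) v" using v by (simp add: d_def lookup_minus)
    then have "k \<noteq> i" using k(2) by (metis edvd_def not_le)
    have ki: "es ! k \<preceq> es ! i"
      using k(2) edvd_single_diff[of "es ! i" v 1] edvd_trans unfolding d_def by blast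
    have "Poly_Mapping.lookup (es ! k) w = 0" for w
    proof -
      have "Poly_Mapping.lookup (es ! i) w = 0 \<or> Poly_Mapping.lookup (es ! k) w = 0"
      proof (cases "k < i")
        case True
        then show ?thesis using less.IH[of i k w] less.prems by auto
      next
        case False
        then show ?thesis using less.IH[of k i w] less.prems k(1) \<open>k \<noteq> i\<close> by auto
      qed
      then show ?thesis using ki by (metis edvd_def le_zero_eq)
    qed
    then have "es ! k = 0" by (intro poly_mapping_eqI) simp
    then show False using nz[of k] k(1) less.prems(2) by simp
  qed
qed

text \<open>One variable chosen from each monomial gives distinct variables. The bound makes the set
  of lengths finite, as the maximum in \<open>Mgrade\<close> requires.\<close>

lemma length_regular_sequence_monomials:
  fixes fs :: "('n::finite, 'k::field) mpoly list"
  assumes reg: "regular_sequence mpoly_ring fs" and mon: "set fs \<subseteq> monomials"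
  shows "length fs \<le> card (UNIV :: 'n set)"
proof -
  obtain es where es: "fs = map monomial es"
    using mon ex_map_conv[of fs monomial] by (auto simp: monomials_def)
  note reg = reg[unfolded es]
  have "\<exists>v. Poly_Mapping.lookup (es ! i) v \<noteq> 0" if "i < length es" for i
  proof (rule ccontr)
    assume "\<not> ?thesis"
    then have "es ! i = 0" by (intro poly_mapping_eqI) simp
    then show False
      using reg that nth_mem[OF that] by (simp add: regular_sequence_monomials_iff)
  qed
  then obtain v where v: "\<And>i. i < length es \<Longrightarrow> Poly_Mapping.lookup (es ! i) (v i) \<noteq> 0" by metis
  have "inj_on v {..<length es}"
  proof (rule inj_onI)
    fix i j assume "i \<in> {..<length es}" "j \<in> {..<length es}" "v i = v j"
    then show "i = j"
      using v[of i] v[of j] regular_sequence_monomials_disjoint[OF reg, of i j "v i"]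
        regular_sequence_monomials_disjoint[OF reg, of j i "v i"]
      by (metis lessThan_iff linorder_neqE_nat)
  qed
  then have "card {..<length es} \<le> card (UNIV :: 'n set)" by (rule card_inj_on_le) auto
  then show ?thesis by (simp add: es)
qed

lemma length_le_Mgrade:
  fixes fs :: "('n::finite, 'k::field) mpoly list"
  assumes "regular_sequence mpoly_ring fs" "set fs \<subseteq> I \<inter> monomials"
  shows "length fs \<le> Mgrade I"
  unfolding Mgrade_def
proof (rule Max_ge)
  have "{length fs | fs. regular_sequence mpoly_ring fs \<and> set fs \<subseteq> I \<inter> monomials} \<subseteq> {..card (UNIV :: 'n set)}"
    using length_regular_sequence_monomials by auto
  then show "finite {length fs | fs. regular_sequence mpoly_ring fs \<and> set fs \<subseteq> I \<inter> monomials}"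
    by (rule finite_subset) simp
qed (use assms in blast)

text \<open>The monomials of the circuits in \<open>D\<close> have disjoint supports and so form a
  regular sequence in the ideal.\<close>

lemma (in cobases) card_good_le_Mgrade:
  assumes D: "good D"
  shows "card D \<le> Mgrade (monomial_ideal (symb 1) :: ('n, 'k::field) mpoly set)"
proof -
  obtain xs where xs: "set xs = D" "distinct xs" using finite_distinct_list[of D] by auto
  have circ: "D \<subseteq> circuits" using D by (simp add: good_def)
  let ?es = "map ind xs"
  have "regular_sequence mpoly_ring (map monomial ?es :: ('n, 'k) mpoly list)"
    unfolding regular_sequence_monomials_iff
  proof (intro conjI allI impI)
    have "ind C \<noteq> 0" if "C \<in> D" for C
    proof -
      have "C \<in> circuits" using that circ by blast
      then obtain i where "i \<in> C" using circuit_nonempty by blast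
      then have "Poly_Mapping.lookup (ind C) i \<noteq> Poly_Mapping.lookup 0 i" by (simp add: lookup_ind)
      then show ?thesis by metis
    qed
    then show "0 \<notin> set ?es" using xs(1) by (metis imageE list.set_map)
    fix i and g :: "('n, 'k) mpoly"
    assume i: "i < length ?es" and g: "monomial (?es ! i) * g \<in> monomial_ideal (up (set (take i ?es)))"
    have "k \<in> up (set (take i ?es))" if k: "k \<in> Poly_Mapping.keys g" for k
    proof -
      have "?es ! i + k \<in> up (set (take i ?es))"
        using keys_monomial_mult[OF k] g by (auto simp: monomial_ideal_def)
      then obtain j where j: "j < i" "ind (xs ! j) \<preceq> ind (xs ! i) + k"
        using i by (auto simp: up_def in_set_conv_nth)
      \<comment> \<open>The earlier circuit is disjoint from the current one, so its monomial must
        divide the cofactor \<open>k\<close> alone.\<close>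
      have "v \<notin> xs ! i" if "v \<in> xs ! j" for v
        using good_disjoint[OF D, of "xs ! i" "xs ! j" v] that xs i j(1)
        by (auto simp: nth_eq_iff_index_eq)
      then have "ind (xs ! j) \<preceq> k"
        using j(2) unfolding edvd_def by (metis add_0 lookup_add lookup_ind zero_le)
      moreover have "ind (xs ! j) \<in> set (take i ?es)"
        using i j(1) by (auto simp: in_set_conv_nth intro!: exI[of _ j])
      ultimately show ?thesis by (auto simp: up_def)
    qed
    then show "g \<in> monomial_ideal (up (set (take i ?es)))" by (auto simp: monomial_ideal_def)
  qed
  moreover have "ind C \<in> symb 1" if "C \<in> D" for C
    using that circ circuit_card by (auto simp: symb_def wt_ind)
  then have "set (map monomial ?es :: ('n, 'k) mpoly list) \<subseteq> monomial_ideal (symb 1) \<inter> monomials"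
    using xs(1) by (auto simp: monomials_def)
  ultimately have "length (map monomial ?es :: ('n, 'k) mpoly list) \<le>
      Mgrade (monomial_ideal (symb 1) :: ('n, 'k) mpoly set)"
    by (rule length_le_Mgrade)
  then show ?thesis using xs distinct_card by fastforce
qed

section \<open>From the matroid to its cobases, and the final count\<close>

lemma matroid_facets_nonempty:
  fixes \<Delta> :: "'n::finite set set"
  assumes "matroid \<Delta>" shows "facets \<Delta> \<noteq> {}"
proof -
  have "\<Delta> \<noteq> {}" using assms by (auto simp: matroid_def simplicial_complex_def)
  then obtain F where "F \<in> \<Delta>" "\<forall>G\<in>\<Delta>. F \<subseteq> G \<longrightarrow> F = G"
    using finite_has_maximal[of \<Delta>] by auto
  then have "F \<in> facets \<Delta>" by (auto simp: facets_def)
  then show ?thesis by blast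
qed

text \<open>Complementation turns the element leaving a basis into the one entering the cobase,
  which is why \<open>exchange\<close> prescribes the entering element.\<close>

lemma cobases_matroid:
  fixes \<Delta> :: "'n::finite set set"
  assumes M: "matroid \<Delta>"
  shows "cobases ((\<lambda>F. UNIV - F) ` facets \<Delta>)"
proof
  show "(\<lambda>F. UNIV - F) ` facets \<Delta> \<noteq> {}" using matroid_facets_nonempty[OF M] by simp
  have "F = G" if "F \<in> facets \<Delta>" "G \<in> facets \<Delta>" "UNIV - F \<subseteq> UNIV - G" for F G
  proof -
    have "G \<subseteq> F" using that(3) by auto
    then show ?thesis using that(1,2) by (auto simp: facets_def)
  qed
  then show "\<forall>B\<in>(\<lambda>F. UNIV - F) ` facets \<Delta>. \<forall>C\<in>(\<lambda>F. UNIV - F) ` facets \<Delta>. B \<subseteq> C \<longrightarrow> B = C"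
    by blast
  fix B B' i
  assume "B \<in> (\<lambda>F. UNIV - F) ` facets \<Delta>" "B' \<in> (\<lambda>F. UNIV - F) ` facets \<Delta>" and i: "i \<in> B' - B"
  then obtain F G where F: "F \<in> facets \<Delta>" "B = UNIV - F" and G: "G \<in> facets \<Delta>" "B' = UNIV - G" by auto
  have "i \<in> F - G" using i F G by auto
  then obtain j where j: "j \<in> G - F" "insert j (F - {i}) \<in> facets \<Delta>"
    using M F(1) G(1) unfolding matroid_def by blast
  have "insert i (B - {j}) = UNIV - insert j (F - {i})" using i j F G by auto
  then show "\<exists>j\<in>B - B'. insert i (B - {j}) \<in> (\<lambda>F. UNIV - F) ` facets \<Delta>"
    using j F G by (intro bexI[of _ j]) auto
qed

theorem theorem5p1:
  fixes I :: "('n::finite, 'k::field) mpoly set" and l :: nat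
  assumes "C_matroidal I" and "l \<ge> 1"
  shows "int (sdefect mpoly_ring I l) =
    int (min_num_gens mpoly_ring (ideal_module mpoly_ring (symbolic_power mpoly_ring I l)))
    - (\<Sum>r = 1..Mgrade I.
        int (card (SF (ideal_power mpoly_ring I r) \<inter> min_monomial_gens (symbolic_power mpoly_ring I r)))
        * (if r \<le> l then int ((l - 1) choose (l - r)) else 0))"
proof -
  obtain \<Delta> where \<Delta>: "matroid \<Delta>" "I = stanley_reisner \<Delta>"
    using assms(1) by (auto simp: C_matroidal_def)
  define \<B> where "\<B> = (\<lambda>F. UNIV - F) ` facets \<Delta>"
  interpret cobases \<B> unfolding \<B>_def by (rule cobases_matroid[OF \<Delta>(1)])
  have I: "I = monomial_ideal (symb 1)"
    unfolding symb_def by (auto simp: \<Delta>(2) stanley_reisner_def var_prime_eq \<B>_def monomial_ideal_def)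
  have sp: "symbolic_power mpoly_ring I r = monomial_ideal (symb r)" for r
    unfolding I symb_def by (rule symbolic_power_cover_ideal[OF antichain])
  have op: "ideal_power mpoly_ring I r = monomial_ideal (pow r)" for r
    unfolding I pow_def by (rule ideal_power_monomial_ideal[OF upset_symb])
  have mu: "min_num_gens mpoly_ring (ideal_module mpoly_ring (symbolic_power mpoly_ring I l)) =
      card (minimal (symb l))"
    unfolding sp by (rule min_num_gens_monomial_ideal[OF upset_symb finite_minimal_symb])
  have "sdefect mpoly_ring I l = card (minimal (symb l) - pow l)"
    unfolding sdefect_def sp op
    by (rule min_num_gens_quotient_monomial_ideal[OF upset_symb finite_minimal_symb upset_pow pow_subset_symb])
  also have "\<dots> = card (minimal (symb l)) - card (minimal (symb l) \<inter> pow l)"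
    by (rule card_Diff_subset_Int) (simp add: finite_minimal_symb)
  \<comment> \<open>The natural subtraction is exact because the intersection is a subset; it can
    pass to the integers.\<close>
  finally have sdefect: "int (sdefect mpoly_ring I l) =
      int (card (minimal (symb l))) - int (card (minimal (symb l) \<inter> pow l))"
    using card_mono[OF finite_minimal_symb, of "minimal (symb l) \<inter> pow l" l] by simp
  have SF: "card (SF (ideal_power mpoly_ring I r) \<inter> min_monomial_gens (symbolic_power mpoly_ring I r)) =
      card {D. good D \<and> card D = r}" for r
  proof -
    \<comment> \<open>A squarefree monomial of the ordinary power that divides a minimal generator
      of the symbolic power lies in the symbolic power, hence equals that generator.\<close>
    have "e \<in> pow r \<and> (\<forall>i. Poly_Mapping.lookup e i \<le> 1)"
      if e: "e \<in> minimal (symb r)" "e \<in> up {e \<in> pow r. \<forall>i. Poly_Mapping.lookup e i \<le> 1}" for e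
    proof -
      obtain a where a: "a \<in> pow r" "\<forall>i. Poly_Mapping.lookup a i \<le> 1" "a \<preceq> e"
        using e(2) by (auto simp: up_def)
      then have "a = e" using e(1) pow_subset_symb by (auto simp: minimal_def)
      then show ?thesis using a by simp
    qed
    then have "minimal (symb r) \<inter> up {e \<in> pow r. \<forall>i. Poly_Mapping.lookup e i \<le> 1} =
        {k \<in> minimal (symb r) \<inter> pow r. \<forall>i. Poly_Mapping.lookup k i \<le> 1}"
      using subset_up[of "{e \<in> pow r. \<forall>i. Poly_Mapping.lookup e i \<le> 1}"] by blast
    moreover have "SF (ideal_power mpoly_ring I r) \<inter> min_monomial_gens (symbolic_power mpoly_ring I r) =
        monomial ` (minimal (symb r) \<inter> up {e \<in> pow r. \<forall>i. Poly_Mapping.lookup e i \<le> 1})"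
      unfolding sp op SF_monomial_ideal min_monomial_gens_monomial_ideal[OF upset_symb] by auto
    ultimately show ?thesis
      by (simp only: card_image[OF inj_on_subset[OF inj_monomial subset_UNIV]]
        card_squarefree_minimal_symb_Int_pow)
  qed
  have "card (minimal (symb l) \<inter> pow l) = (\<Sum>r = 1..Mgrade I.
      card {D. good D \<and> card D = r} * (if r \<le> l then (l - 1) choose (l - r) else 0))"
    using card_good_le_Mgrade[where 'k = 'k] assms(2) unfolding I
    by (intro card_minimal_symb_Int_pow) auto
  then have "int (card (minimal (symb l) \<inter> pow l)) = (\<Sum>r = 1..Mgrade I.
      int (card {D. good D \<and> card D = r}) * (if r \<le> l then int ((l - 1) choose (l - r)) else 0))"
    by (simp only: of_nat_sum of_nat_mult) (intro sum.cong, auto)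
  then show ?thesis unfolding sdefect mu SF by simp
qed

end
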